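(* Suppose that the problem $u_{tt}=Au+f(t,u(t))$ for $t\in(0,T)$, $u(0)=\varphi$, $u_t(0)=g$, has a weak (mild) solution $u$ which satisfies, for $t\in[0,T]$, $$\sum_{p=1}^\infty e^{2\sqrt{\lambda_p}(T-t)}\Big(\langle u(t),\phi_p\rangle+\frac{\langle u_t(t),\phi_p\rangle}{\sqrt{\lambda_p}}\Big)^2\le P^2$$ for a positive number $P$. Let $\epsilon>0$ and let $(\varphi^\epsilon,g^\epsilon)\in H\times H$ be measured data satisfying $\|\varphi^\epsilon-\varphi\|\le\epsilon$ and $\|g^\epsilon-g\|\le\epsilon$. Then one can construct a regularized solution $U^\epsilon$ (the construction is described in the context) such that $$\|U^\epsilon(t)-u(t)\|\le C\,\epsilon^{1-\frac tT}\quad\text{for } t\in[0,T),\qquad \|U^\epsilon(t)-u(t)\|\le (D+C)\sqrt{\frac{T}{\ln(1/\epsilon)}}\quad\text{for } t=T,$$ where $$C=2P\exp\Big\{\frac{K^2T^2}{\lambda_1}\Big\}+\sqrt{3\Big(1+\frac1{\lambda_1}\Big)}\,\exp\Big\{\frac{3TK^2}{2\lambda_1}\Big\},\qquad D=\sup_{0\le t\le T}\|u_t(t)\|.$$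
   Context: $H$ is a Hilbert space with inner product $\langle\cdot,\cdot\rangle$ and norm $\|\cdot\|$; $A:D(A)\subset H\to H$ is a positive-definite self-adjoint operator with compact inverse; $\{\phi_p\}_{p\ge1}$ is an orthonormal basis of $H$ of eigenvectors of $A$, with eigenvalues $0<\lambda_1\le\lambda_2\le\cdots$, $\lambda_p\to\infty$. $T>0$, $\varphi,g\in H$. The source $f:\mathbb{R}\times H\to H$ satisfies $\|f(t,w)-f(t,v)\|\le K\|w-v\|$ with a constant $K>0$ independent of $w,v\in H$, $t\in\mathbb{R}$. Write $\varphi_p=\langle\varphi,\phi_p\rangle$, $g_p=\langle g,\phi_p\rangle$, $\varphi^\epsilon_p=\langle\varphi^\epsilon,\phi_p\rangle$, $g^\epsilon_p=\langle g^\epsilon,\phi_p\rangle$, $f_p(w)(s)=\langle f(s,w(s)),\phi_p\rangle$. A mild solution of the problem is $u\in C([0,T];H)$ with $$u(t)=\sum_{p=1}^\infty\Big[\cosh(\sqrt{\lambda_p}t)\varphi_p+\frac{\sinh(\sqrt{\lambda_p}t)}{\sqrt{\lambda_p}}g_p+\int_0^t\frac{\sinh(\sqrt{\lambda_p}(t-s))}{\sqrt{\lambda_p}}f_p(u)(s)\,ds\Big]\phi_p.$$ For $\epsilon>0$ and $\tau\ge0$ put $Q(\epsilon,\lambda_p)=\dfrac{e^{-\sqrt{\lambda_p}T}}{\epsilon+e^{-\sqrt{\lambda_p}T}}$, $\cosh^\epsilon(\sqrt{\lambda_p}\tau)=\tfrac12\big(Q(\epsilon,\lambda_p)e^{\sqrt{\lambda_p}\tau}+e^{-\sqrt{\lambda_p}\tau}\big)$,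 $\sinh^\epsilon(\sqrt{\lambda_p}\tau)=\tfrac12\big(Q(\epsilon,\lambda_p)e^{\sqrt{\lambda_p}\tau}-e^{-\sqrt{\lambda_p}\tau}\big)$ (the superscript $\epsilon$ is not a power). Construction of $U^\epsilon$: let $u^\epsilon\in C([0,T];H)$ be the unique solution of $$u^\epsilon(t)=\sum_{p=1}^\infty\Big[\cosh^\epsilon(\sqrt{\lambda_p}t)\varphi^\epsilon_p+\frac{\sinh^\epsilon(\sqrt{\lambda_p}t)}{\sqrt{\lambda_p}}g^\epsilon_p+\int_0^t\frac{\sinh^\epsilon(\sqrt{\lambda_p}(t-s))}{\sqrt{\lambda_p}}f_p(u^\epsilon)(s)\,ds\Big]\phi_p .$$ Let $t_\epsilon\in(0,T)$ be the unique number with $(T-t_\epsilon)^2=\epsilon^{2-2t_\epsilon/T}$. Then $U^\epsilon(t)=u^\epsilon(t)$ for $t\in[0,T)$ and $U^\epsilon(T)=u^\epsilon(t_\epsilon)$.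
   Formalization: The last exponent in C is 3T²K²/(2λ₁) instead of 3TK²/(2λ₁), since the printed bound fails for large T; ε<1 is assumed; the bound at t=T is claimed for ε<T, when t_ε exists; f(·,w) is assumed integrable on [0,T] for each w. *)

theory Defs
  imports "HOL-Analysis.Analysis"
begin

text \<open>
  An unbounded operator is a function \<^term>\<open>A\<close> together with its domain \<^term>\<open>D\<close>; values of
  \<^term>\<open>A\<close> outside \<^term>\<open>D\<close> are irrelevant.
\<close>

definition densely_defined :: "'h::real_inner set \<Rightarrow> ('h \<Rightarrow> 'h) \<Rightarrow> bool" where
  "densely_defined D A \<longleftrightarrow>
     subspace D \<and> closure D = UNIV \<and>
     (\<forall>x\<in>D. \<forall>y\<in>D. A (x + y) = A x + A y) \<and> (\<forall>c. \<forall>x\<in>D. A (c *\<^sub>R x) = c *\<^sub>R A x)"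

text \<open>
  The left-hand side of the equivalence says that \<open>(y, z)\<close> lies in the graph of the adjoint, so
  the adjoint and \<^term>\<open>A\<close> have the same domain and the same values.
\<close>

definition self_adjoint :: "'h::real_inner set \<Rightarrow> ('h \<Rightarrow> 'h) \<Rightarrow> bool" where
  "self_adjoint D A \<longleftrightarrow>
     densely_defined D A \<and>
     (\<forall>y z. (\<forall>x\<in>D. inner (A x) y = inner x z) \<longleftrightarrow> y \<in> D \<and> A y = z)"

definition positive_definite :: "'h::real_inner set \<Rightarrow> ('h \<Rightarrow> 'h) \<Rightarrow> bool" where
  "positive_definite D A \<longleftrightarrow> (\<forall>x\<in>D. x \<noteq> 0 \<longrightarrow> inner (A x) x > 0)"

definition has_compact_inverse :: "'h::real_inner set \<Rightarrow> ('h \<Rightarrow> 'h) \<Rightarrow> bool" where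
  "has_compact_inverse D A \<longleftrightarrow>
     bij_betw A D UNIV \<and> (\<forall>B. bounded B \<longrightarrow> compact (closure (inv_into D A ` B)))"

definition orthonormal_basis :: "(nat \<Rightarrow> 'h::real_inner) \<Rightarrow> bool" where
  "orthonormal_basis e \<longleftrightarrow>
     (\<forall>p q. inner (e p) (e q) = (if p = q then 1 else 0)) \<and> closure (span (range e)) = UNIV"

text \<open>Indices start at \<open>0\<close>, so the smallest eigenvalue is \<open>lam 0\<close>.\<close>

definition eigenbasis ::
  "'h::real_inner set \<Rightarrow> ('h \<Rightarrow> 'h) \<Rightarrow> (nat \<Rightarrow> 'h) \<Rightarrow> (nat \<Rightarrow> real) \<Rightarrow> bool" where
  "eigenbasis D A e lam \<longleftrightarrow>
     orthonormal_basis e \<and> (\<forall>p. e p \<in> D \<and> A (e p) = lam p *\<^sub>R e p) \<and>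
     0 < lam 0 \<and> mono lam \<and> filterlim lam at_top sequentially"

text \<open>
  Only continuous \<open>u\<close> and sources with \<open>f(\<cdot>, w)\<close> Bochner integrable on \<open>[0, T]\<close> and uniformly
  Lipschitz in \<open>w\<close> are considered below; then \<open>s \<mapsto> f s (u s)\<close> is integrable on \<open>[0, T]\<close>, so none
  of the integrals takes the default value \<open>0\<close>.
\<close>

definition mild_solution ::
  "(nat \<Rightarrow> 'h::real_inner) \<Rightarrow> (nat \<Rightarrow> real) \<Rightarrow> real \<Rightarrow> (real \<Rightarrow> 'h \<Rightarrow> 'h) \<Rightarrow> 'h \<Rightarrow> 'h \<Rightarrow>
     (real \<Rightarrow> 'h) \<Rightarrow> bool" where
  "mild_solution e lam T f \<phi> g u \<longleftrightarrow>
     continuous_on {0..T} u \<and>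
     (\<forall>t\<in>{0..T}.
        (\<lambda>p. (cosh (sqrt (lam p) * t) * inner \<phi> (e p)
              + sinh (sqrt (lam p) * t) / sqrt (lam p) * inner g (e p)
              + (LBINT s:{0..t}. sinh (sqrt (lam p) * (t - s)) / sqrt (lam p) * inner (f s (u s)) (e p)))
             *\<^sub>R e p) sums u t)"

text \<open>In the next three definitions \<open>l\<close> stands for an eigenvalue.\<close>

definition Q_reg :: "real \<Rightarrow> real \<Rightarrow> real \<Rightarrow> real" where
  "Q_reg T \<epsilon> l = exp (- (sqrt l * T)) / (\<epsilon> + exp (- (sqrt l * T)))"

definition cosh_reg :: "real \<Rightarrow> real \<Rightarrow> real \<Rightarrow> real \<Rightarrow> real" where
  "cosh_reg T \<epsilon> l \<tau> = (Q_reg T \<epsilon> l * exp (sqrt l * \<tau>) + exp (- (sqrt l * \<tau>))) / 2"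

definition sinh_reg :: "real \<Rightarrow> real \<Rightarrow> real \<Rightarrow> real \<Rightarrow> real" where
  "sinh_reg T \<epsilon> l \<tau> = (Q_reg T \<epsilon> l * exp (sqrt l * \<tau>) - exp (- (sqrt l * \<tau>))) / 2"

definition regularized_mild_solution ::
  "(nat \<Rightarrow> 'h::real_inner) \<Rightarrow> (nat \<Rightarrow> real) \<Rightarrow> real \<Rightarrow> (real \<Rightarrow> 'h \<Rightarrow> 'h) \<Rightarrow> real \<Rightarrow> 'h \<Rightarrow> 'h \<Rightarrow>
     (real \<Rightarrow> 'h) \<Rightarrow> bool" where
  "regularized_mild_solution e lam T f \<epsilon> \<phi> g v \<longleftrightarrow>
     continuous_on {0..T} v \<and>
     (\<forall>t\<in>{0..T}.
        (\<lambda>p. (cosh_reg T \<epsilon> (lam p) t * inner \<phi> (e p)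
              + sinh_reg T \<epsilon> (lam p) t / sqrt (lam p) * inner g (e p)
              + (LBINT s:{0..t}. sinh_reg T \<epsilon> (lam p) (t - s) / sqrt (lam p) * inner (f s (v s)) (e p)))
             *\<^sub>R e p) sums v t)"

definition cutoff_time :: "real \<Rightarrow> real \<Rightarrow> real \<Rightarrow> bool" where
  "cutoff_time T \<epsilon> s \<longleftrightarrow> 0 < s \<and> s < T \<and> (T - s)\<^sup>2 = \<epsilon> powr (2 - 2 * s / T)"

text \<open>
  For \<open>0 < \<epsilon> < 1\<close> a cut-off time exists iff \<open>\<epsilon> < T\<close>, and it is then unique; only in that case is
  the value at \<open>T\<close> meaningful.
\<close>

definition regularized_solution :: "real \<Rightarrow> real \<Rightarrow> (real \<Rightarrow> 'h) \<Rightarrow> real \<Rightarrow> 'h" where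
  "regularized_solution T \<epsilon> v t = (if t < T then v t else v (THE s. cutoff_time T \<epsilon> s))"

text \<open>
  The last exponent carries \<open>T\<^sup>2\<close>, which is what Gronwall's inequality yields.  With \<open>3 T K\<^sup>2\<close>
  in place of \<open>3 T\<^sup>2 K\<^sup>2\<close> the error estimate is false for large \<open>T\<close>: take \<open>f(t, w) = K w\<close>,
  \<open>u = 0\<close> with zero data and \<open>P\<close> tiny, noisy data \<open>\<epsilon> e\<^sub>0\<close> in both components, \<open>T = 200\<close>,
  \<open>lam 0 = 25\<close>, \<open>K = 3/4\<close>, \<open>\<epsilon> = exp(-1000) / 10\<close>, and \<open>t\<close> close to \<open>T\<close>.  For \<open>T \<le> 1\<close> this
  constant is at most the one with \<open>3 T K\<^sup>2\<close>.
\<close>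

definition error_const :: "real \<Rightarrow> real \<Rightarrow> real \<Rightarrow> real \<Rightarrow> real" where
  "error_const T K l P =
     2 * P * exp (K\<^sup>2 * T\<^sup>2 / l) + sqrt (3 * (1 + 1 / l)) * exp (3 * T\<^sup>2 * K\<^sup>2 / (2 * l))"

end

theory Submission
  imports Defs
begin

text \<open>
  Write \<open>q = sqrt (lam p)\<close> and \<open>\<mu> = ln (1 / \<epsilon>) / T\<close>, so that \<open>\<epsilon> powr (1 - t / T) = \<epsilon> * exp (\<mu> * t)\<close>.
  The initial value problem is ill-posed because mode \<open>p\<close> amplifies errors by \<open>exp (q * t)\<close>, with
  \<open>q\<close> unbounded.  The regularization multiplies only this growing exponential by the filter
  \<open>Q = x / (\<epsilon> + x)\<close>, \<open>x = exp (- q * T)\<close>.  Two properties of \<open>Q\<close> carry the theorem.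

  First, \<open>Q * exp (q * \<tau>) \<le> exp (\<mu> * \<tau>)\<close> for all \<open>q\<close> (\<open>Q_reg_exp_bound\<close>).  Hence the regularized
  cosine and sine families are bounded, strongly continuous families of diagonal operators whose
  norms grow at most like \<open>exp (\<mu> * \<tau>)\<close>, and the regularized problem is a Volterra equation with a
  Lipschitz source.  A contraction in a weighted supremum norm gives existence
  (\<open>volterra_existence\<close>); Gronwall's inequality after division by \<open>exp (\<mu> * t)\<close> gives uniqueness and
  continuous dependence (\<open>volterra_stability\<close>).

  Second, the exact solution \<open>u\<close> solves the regularized equation up to a small residual.  In
  \<open>u\<^sub>p + u\<^sub>p' / q\<close> the decaying exponentials cancel, so this sum is twice the growing part of mode
  \<open>p\<close>, and the filter removes exactly \<open>(1 - Q) / 2 * (u\<^sub>p + u\<^sub>p' / q)\<close> (\<open>mode_residual\<close>).  Since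
  \<open>1 - Q = \<epsilon> * Q * exp (q * T)\<close>, the first property yields
  \<open>1 - Q \<le> \<epsilon> * exp (\<mu> * t) * exp (q * (T - t))\<close>, and the a priori bound \<open>P\<close> on the weighted sum turns
  this into a residual of norm at most \<open>P / 2 * \<epsilon> * exp (\<mu> * t)\<close>.

  Noise in the data and residual together perturb the Volterra equation by
  \<open>(1 + 1 / (2 * sqrt (lam 0)) + P / 2) * \<epsilon> * exp (\<mu> * t)\<close>, and stability multiplies this by
  \<open>exp (K * t / (2 * sqrt (lam 0)))\<close>.  Estimating norms with the triangle inequality, instead of
  their squares, keeps this constant below \<open>error_const\<close> (\<open>error_const_dominates\<close>).

  At \<open>t = T\<close> the factor \<open>\<epsilon> powr (1 - t / T)\<close> no longer decays.  The cut-off time \<open>s\<close> is where it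
  equals \<open>T - s\<close>; there the error bound and the mean value inequality for \<open>u\<close> on \<open>{s..T}\<close> are both
  multiples of \<open>T - s\<close>, which is at most \<open>sqrt (T / ln (1 / \<epsilon>))\<close> because \<open>x * exp (- x) \<le> 1\<close>.
\<close>

section \<open>Orthonormal expansions and diagonal operators\<close>

lemma inner_onb_sum:
  assumes "orthonormal_basis e" "finite I"
  shows "inner (\<Sum>p\<in>I. a p *\<^sub>R e p) (e q) = (if q \<in> I then a q else 0)"
proof -
  have "inner (\<Sum>p\<in>I. a p *\<^sub>R e p) (e q) = (\<Sum>p\<in>I. if p = q then a q else 0)"
    unfolding inner_sum_left using assms(1)
    by (intro sum.cong) (auto simp: orthonormal_basis_def)
  then show ?thesis using assms(2) by simp
qed

lemma norm_onb_sum: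
  assumes "orthonormal_basis e" "finite I"
  shows "(norm (\<Sum>p\<in>I. a p *\<^sub>R e p))\<^sup>2 = (\<Sum>p\<in>I. (a p)\<^sup>2)"
proof -
  have "(norm (\<Sum>p\<in>I. a p *\<^sub>R e p))\<^sup>2 = (\<Sum>q\<in>I. a q * inner (\<Sum>p\<in>I. a p *\<^sub>R e p) (e q))"
    unfolding power2_norm_eq_inner by (subst inner_sum_right) simp
  also have "\<dots> = (\<Sum>q\<in>I. (a q)\<^sup>2)"
    by (intro sum.cong) (auto simp: inner_onb_sum[OF assms] power2_eq_square)
  finally show ?thesis .
qed

text \<open>
  Pythagoras for the orthogonal projection onto the span of the \<open>e p\<close> with \<open>p \<in> I\<close>: Bessel's
  inequality and the contractivity of \<open>x \<mapsto> x - (\<Sum>p\<in>I. inner x (e p) *\<^sub>R e p)\<close> both follow.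
\<close>

lemma bessel_defect:
  assumes "orthonormal_basis e" "finite I"
  shows "(norm (x - (\<Sum>p\<in>I. inner x (e p) *\<^sub>R e p)))\<^sup>2
           = (norm x)\<^sup>2 - (\<Sum>p\<in>I. (inner x (e p))\<^sup>2)"
proof -
  let ?s = "\<Sum>p\<in>I. inner x (e p) *\<^sub>R e p"
  have "inner x ?s = (\<Sum>p\<in>I. (inner x (e p))\<^sup>2)"
    by (simp add: inner_sum_right power2_eq_square)
  moreover have "inner ?s ?s = (\<Sum>p\<in>I. (inner x (e p))\<^sup>2)"
    using norm_onb_sum[OF assms] by (simp add: power2_norm_eq_inner)
  ultimately show ?thesis
    by (simp add: power2_norm_eq_inner inner_diff_left inner_diff_right inner_commute)
qed

lemma bessel_inequality:
  assumes "orthonormal_basis e" "finite I"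
  shows "(\<Sum>p\<in>I. (inner x (e p))\<^sup>2) \<le> (norm x)\<^sup>2"
  using bessel_defect[OF assms, of x] by (metis diff_ge_0_iff_ge zero_le_power2)

text \<open>
  On finite linear combinations of the basis the partial sums are eventually exact.  The map
  \<open>x \<mapsto> x - Pr n x\<close> is linear and does not increase norms, so the convergence passes to the closure.
\<close>

lemma onb_expansion:
  assumes e: "orthonormal_basis e"
  shows "(\<lambda>p. inner x (e p) *\<^sub>R e p) sums x"
proof -
  define Pr where "Pr = (\<lambda>n x. \<Sum>p<n. inner x (e p) *\<^sub>R e p)"
  have Pr_diff: "Pr n x - Pr n y = Pr n (x - y)" for n x y
    by (simp add: Pr_def inner_diff_left scaleR_left_diff_distrib sum_subtractf)
  have Pr_contr: "norm (x - Pr n x) \<le> norm x" for n x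
  proof (rule power2_le_imp_le)
    show "(norm (x - Pr n x))\<^sup>2 \<le> (norm x)\<^sup>2"
      unfolding Pr_def by (subst bessel_defect[OF e]) (auto intro: sum_nonneg)
  qed simp
  define V where "V = {y. \<forall>\<^sub>F n in sequentially. Pr n y = y}"
  have "subspace V"
  proof (rule subspaceI)
    show "0 \<in> V" by (simp add: V_def Pr_def)
    show "x + y \<in> V" if "x \<in> V" "y \<in> V" for x y
    proof -
      have "\<forall>\<^sub>F n in sequentially. Pr n x = x \<and> Pr n y = y"
        using that by (simp add: V_def eventually_conj)
      then show ?thesis unfolding V_def mem_Collect_eq
        by eventually_elim (simp add: Pr_def inner_add_left scaleR_left_distrib sum.distrib)
    qed
    show "c *\<^sub>R x \<in> V" if "x \<in> V" for c x
      using that unfolding V_def mem_Collect_eq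
      by eventually_elim (simp add: Pr_def scaleR_sum_right[symmetric] flip: scaleR_scaleR)
  qed
  moreover have "range e \<subseteq> V"
  proof
    fix y assume "y \<in> range e"
    then obtain q where q: "y = e q" by auto
    have "Pr n y = y" if "n > q" for n
    proof -
      have "Pr n y = (\<Sum>p<n. if p = q then e q else 0)"
        unfolding Pr_def q using e by (intro sum.cong) (auto simp: orthonormal_basis_def)
      then show ?thesis using that q by simp
    qed
    then show "y \<in> V" unfolding V_def mem_Collect_eq
      by (intro eventually_sequentiallyI[of "Suc q"]) auto
  qed
  ultimately have V: "span (range e) \<subseteq> V" by (simp add: span_minimal)
  have "(\<lambda>n. Pr n x) \<longlonglongrightarrow> x"
  proof (rule tendstoI)
    fix \<delta> :: real assume "\<delta> > 0"
    have "x \<in> closure (span (range e))" using e by (simp add: orthonormal_basis_def)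
    then obtain y where y: "y \<in> span (range e)" "dist y x < \<delta>"
      using \<open>\<delta> > 0\<close> closure_approachable by blast
    have "\<forall>\<^sub>F n in sequentially. Pr n y = y" using V y by (auto simp: V_def)
    then show "\<forall>\<^sub>F n in sequentially. dist (Pr n x) x < \<delta>"
    proof eventually_elim
      case (elim n)
      have "x - Pr n x = (x - y) - Pr n (x - y)" using Pr_diff[of n x y] elim by (simp add: algebra_simps)
      then have "norm (x - Pr n x) \<le> norm (x - y)" using Pr_contr[of "x - y" n] by metis
      then show ?case using y by (simp add: dist_norm norm_minus_commute)
    qed
  qed
  then show ?thesis by (simp add: sums_def Pr_def)
qed

lemma onb_coefficient:
  assumes "orthonormal_basis e" "(\<lambda>p. a p *\<^sub>R e p) sums x"
  shows "inner x (e q) = a q"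
proof -
  have "(\<lambda>p. inner (a p *\<^sub>R e p) (e q)) sums inner x (e q)"
    using assms(2) by (rule bounded_linear.sums[OF bounded_linear_inner_left])
  moreover have "(\<lambda>p. inner (a p *\<^sub>R e p) (e q)) = (\<lambda>p. if p = q then a q else 0)"
    using assms(1) by (auto simp: orthonormal_basis_def fun_eq_iff)
  ultimately show ?thesis using sums_single[of q "\<lambda>_. a q"] sums_unique2 by metis
qed

text \<open>
  This turns the series in the definitions of mild solutions into equations for the coefficients.
\<close>

lemma onb_sums_iff:
  assumes "orthonormal_basis e"
  shows "(\<lambda>p. a p *\<^sub>R e p) sums x \<longleftrightarrow> (\<forall>p. inner x (e p) = a p)"
proof
  assume "(\<lambda>p. a p *\<^sub>R e p) sums x"
  then show "\<forall>p. inner x (e p) = a p" using onb_coefficient[OF assms] by blast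
next
  assume "\<forall>p. inner x (e p) = a p"
  then show "(\<lambda>p. a p *\<^sub>R e p) sums x" using onb_expansion[OF assms, of x] by simp
qed

lemma onb_norm_bound:
  assumes e: "orthonormal_basis e" and "B \<ge> 0"
    and le: "\<And>n. (\<Sum>p<n. (inner x (e p))\<^sup>2) \<le> B\<^sup>2"
  shows "norm x \<le> B"
proof (rule LIMSEQ_le_const2)
  show "(\<lambda>n. norm (\<Sum>p<n. inner x (e p) *\<^sub>R e p)) \<longlonglongrightarrow> norm x"
    using onb_expansion[OF e, of x] unfolding sums_def by (rule tendsto_norm)
  have "norm (\<Sum>p<n. inner x (e p) *\<^sub>R e p) \<le> B" for n
  proof (rule power2_le_imp_le)
    show "(norm (\<Sum>p<n. inner x (e p) *\<^sub>R e p))\<^sup>2 \<le> B\<^sup>2"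
      unfolding norm_onb_sum[OF e finite_lessThan] by (rule le)
  qed fact
  then show "\<exists>N. \<forall>n\<ge>N. norm (\<Sum>p<n. inner x (e p) *\<^sub>R e p) \<le> B" by blast
qed

lemma onb_eqI:
  assumes "orthonormal_basis e" "\<And>p. inner x (e p) = inner y (e p)"
  shows "x = y"
  using onb_expansion[OF assms(1), of x] onb_expansion[OF assms(1), of y]
  unfolding assms(2) by (rule sums_unique2)

definition diagonal_operator :: "(nat \<Rightarrow> 'h::real_inner) \<Rightarrow> (nat \<Rightarrow> real) \<Rightarrow> 'h \<Rightarrow> 'h" where
  "diagonal_operator e c x = (\<Sum>p. (c p * inner x (e p)) *\<^sub>R e p)"

text \<open>
  The series converges because its partial sums are Cauchy: orthogonality bounds the squared norm of
  a block by \<open>M\<^sup>2\<close> times a block of the convergent series of squared coefficients.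
\<close>

lemma inner_diagonal_operator:
  fixes e :: "nat \<Rightarrow> 'h::{real_inner, banach}"
  assumes e: "orthonormal_basis e" and c: "\<And>p. \<bar>c p\<bar> \<le> M"
  shows "inner (diagonal_operator e c x) (e q) = c q * inner x (e q)"
proof -
  have "summable (\<lambda>p. (inner x (e p))\<^sup>2)"
    by (intro summableI_nonneg_bounded[of _ "(norm x)\<^sup>2"]) (auto intro: bessel_inequality[OF e])
  then have "summable (\<lambda>p. M\<^sup>2 * (inner x (e p))\<^sup>2)" by (rule summable_mult)
  then have sq: "summable (\<lambda>p. (c p * inner x (e p))\<^sup>2)"
  proof (rule summable_comparison_test'[where N = 0])
    show "norm ((c p * inner x (e p))\<^sup>2) \<le> M\<^sup>2 * (inner x (e p))\<^sup>2" for p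
      using power_mono[OF c[of p], of 2] by (simp add: power_mult_distrib mult_right_mono)
  qed
  have "summable (\<lambda>p. (c p * inner x (e p)) *\<^sub>R e p)"
    unfolding summable_Cauchy
  proof (intro allI impI)
    fix \<delta> :: real assume "\<delta> > 0"
    then have "\<delta>\<^sup>2 > 0" by simp
    then obtain N where N: "\<And>m n. m \<ge> N \<Longrightarrow> norm (\<Sum>p=m..<n. (c p * inner x (e p))\<^sup>2) < \<delta>\<^sup>2"
      using sq[unfolded summable_Cauchy, rule_format, of "\<delta>\<^sup>2"] by blast
    have "norm (\<Sum>p=m..<n. (c p * inner x (e p)) *\<^sub>R e p) < \<delta>" if "m \<ge> N" for m n
    proof (rule power2_less_imp_less)
      show "(norm (\<Sum>p=m..<n. (c p * inner x (e p)) *\<^sub>R e p))\<^sup>2 < \<delta>\<^sup>2"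
        using N[OF that, of n] unfolding norm_onb_sum[OF e finite_atLeastLessThan]
        by (metis abs_le_D1 le_less_trans order_refl real_norm_def)
    qed (use \<open>\<delta> > 0\<close> in simp)
    then show "\<exists>N. \<forall>m\<ge>N. \<forall>n. norm (\<Sum>p=m..<n. (c p * inner x (e p)) *\<^sub>R e p) < \<delta>" by blast
  qed
  then have "(\<lambda>p. (c p * inner x (e p)) *\<^sub>R e p) sums diagonal_operator e c x"
    by (simp add: diagonal_operator_def summable_sums)
  from onb_coefficient[OF e this] show ?thesis .
qed

lemma norm_diagonal_operator_le:
  fixes e :: "nat \<Rightarrow> 'h::{real_inner, banach}"
  assumes e: "orthonormal_basis e" and c: "\<And>p. \<bar>c p\<bar> \<le> M"
  shows "norm (diagonal_operator e c x) \<le> M * norm x"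
proof (rule onb_norm_bound[OF e])
  have "M \<ge> 0" using c[of 0] by linarith
  then show "0 \<le> M * norm x" by simp
  fix n
  have "(\<Sum>p<n. (inner (diagonal_operator e c x) (e p))\<^sup>2) \<le> (\<Sum>p<n. M\<^sup>2 * (inner x (e p))\<^sup>2)"
  proof (rule sum_mono)
    show "(inner (diagonal_operator e c x) (e p))\<^sup>2 \<le> M\<^sup>2 * (inner x (e p))\<^sup>2" for p
      using power_mono[OF c[of p], of 2]
      by (simp add: inner_diagonal_operator[OF e c] power_mult_distrib mult_right_mono)
  qed
  also have "\<dots> \<le> M\<^sup>2 * (norm x)\<^sup>2"
    unfolding sum_distrib_left[symmetric] by (intro mult_left_mono bessel_inequality[OF e]) auto
  finally show "(\<Sum>p<n. (inner (diagonal_operator e c x) (e p))\<^sup>2) \<le> (M * norm x)\<^sup>2"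
    by (simp add: power_mult_distrib)
qed

lemma linear_diagonal_operator:
  fixes e :: "nat \<Rightarrow> 'h::{real_inner, banach}"
  assumes e: "orthonormal_basis e" and c: "\<And>p. \<bar>c p\<bar> \<le> M"
  shows "linear (diagonal_operator e c)"
  by (rule linearI; rule onb_eqI[OF e])
    (simp_all add: inner_diagonal_operator[OF e c] inner_add_left algebra_simps)

text \<open>
  Cutting the series off after \<open>n\<close> terms changes it by the operator applied to the tail of \<open>x\<close>; the
  uniform bound on the coefficients makes this error uniform in \<open>\<tau>\<close>.
\<close>

lemma continuous_diagonal_operator:
  fixes e :: "nat \<Rightarrow> 'h::{real_inner, banach}"
  assumes e: "orthonormal_basis e" and c: "\<And>p \<tau>. \<bar>c p \<tau>\<bar> \<le> M"
    and cont: "\<And>p. continuous_on UNIV (c p)"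
  shows "continuous_on UNIV (\<lambda>\<tau>::real. diagonal_operator e (\<lambda>p. c p \<tau>) x)"
proof (rule uniform_limit_theorem)
  define R where "R = (\<lambda>n. x - (\<Sum>p<n. inner x (e p) *\<^sub>R e p))"
  have "R \<longlonglongrightarrow> x - x"
    unfolding R_def using onb_expansion[OF e, of x] unfolding sums_def by (intro tendsto_intros)
  then have R0: "(\<lambda>n. M * norm (R n)) \<longlonglongrightarrow> 0"
    by (auto intro!: tendsto_mult_right_zero tendsto_norm_zero)
  let ?s = "\<lambda>n \<tau>. \<Sum>p<n. (c p \<tau> * inner x (e p)) *\<^sub>R e p"
  have eq: "diagonal_operator e (\<lambda>p. c p \<tau>) x - ?s n \<tau> = diagonal_operator e (\<lambda>p. c p \<tau>) (R n)" for n \<tau>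
    by (rule onb_eqI[OF e])
      (simp add: inner_diagonal_operator[OF e c] inner_diff_left R_def inner_onb_sum[OF e] algebra_simps)
  have le: "dist (?s n \<tau>) (diagonal_operator e (\<lambda>p. c p \<tau>) x) \<le> M * norm (R n)" for n \<tau>
    using norm_diagonal_operator_le[OF e, of "\<lambda>p. c p \<tau>" M "R n", OF c]
    by (simp add: dist_norm norm_minus_commute eq)
  show "uniform_limit UNIV ?s (\<lambda>\<tau>. diagonal_operator e (\<lambda>p. c p \<tau>) x) sequentially"
  proof (rule uniform_limitI)
    fix \<delta> :: real assume "\<delta> > 0"
    have "\<forall>\<^sub>F n in sequentially. M * norm (R n) < \<delta>"
      using order_tendstoD(2)[OF R0 \<open>\<delta> > 0\<close>] .
    then show "\<forall>\<^sub>F n in sequentially. \<forall>\<tau>\<in>UNIV. dist (?s n \<tau>) (diagonal_operator e (\<lambda>p. c p \<tau>) x) < \<delta>"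
      by eventually_elim (use le le_less_trans in blast)
  qed
  show "\<forall>\<^sub>F n in sequentially. continuous_on UNIV (?s n)"
    by (intro always_eventually allI continuous_intros cont)
qed simp

section \<open>Convolution with a strongly continuous operator family\<close>

text \<open>
  Measurability: replacing \<open>v s\<close> by its value at the grid point \<open>d n s\<close> leaves countably many measurable
  pieces, and the Lipschitz condition allows the limit \<open>n \<longlonglongrightarrow> \<infinity>\<close>.  Integrability: the Lipschitz
  condition bounds \<open>f s (v s)\<close> by \<open>f s 0\<close> and the supremum of \<open>v\<close>.
\<close>

lemma composition_set_integrable:
  fixes f :: "real \<Rightarrow> 'a::{banach, second_countable_topology} \<Rightarrow> 'a"
  assumes T: "0 \<le> T"
    and lip: "\<And>t w v. norm (f t w - f t v) \<le> K * norm (w - v)"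
    and int: "\<And>w. set_integrable lborel {0..T} (\<lambda>t. f t w)"
    and v: "continuous_on {0..T} v"
  shows "set_integrable lborel {0..T} (\<lambda>s. f s (v s))"
proof -
  \<comment> \<open>extending \<open>v\<close> to the whole line keeps the grid points in its domain\<close>
  define V where "V = (\<lambda>s. v (max 0 (min T s)))"
  have V: "continuous_on UNIV V"
    unfolding V_def using T by (intro continuous_on_compose2[OF v]) (auto intro!: continuous_intros)
  have meas: "(\<lambda>s. indicator {0..T} s *\<^sub>R f s w) \<in> borel_measurable lborel" for w
    using int[of w] unfolding set_integrable_def by (rule borel_measurable_integrable)
  define d where "d = (\<lambda>n s. real_of_int \<lfloor>real (Suc n) * s\<rfloor> / real (Suc n))"
  have d: "(\<lambda>n. d n s) \<longlonglongrightarrow> s" for s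
  proof (rule tendsto_sandwich)
    show "\<forall>\<^sub>F n in sequentially. s - 1 / real (Suc n) \<le> d n s"
    proof (intro always_eventually allI)
      fix n
      have "real (Suc n) * s - 1 \<le> of_int \<lfloor>real (Suc n) * s\<rfloor>" by linarith
      then have "(real (Suc n) * s - 1) / real (Suc n) \<le> d n s"
        unfolding d_def by (intro divide_right_mono) auto
      then show "s - 1 / real (Suc n) \<le> d n s" by (simp add: diff_divide_distrib)
    qed
    show "\<forall>\<^sub>F n in sequentially. d n s \<le> s"
    proof (intro always_eventually allI)
      fix n
      have "of_int \<lfloor>real (Suc n) * s\<rfloor> \<le> real (Suc n) * s" by linarith
      then have "d n s \<le> real (Suc n) * s / real (Suc n)"
        unfolding d_def by (intro divide_right_mono) auto
      then show "d n s \<le> s" by simp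
    qed
    have "(\<lambda>n. s - 1 / real (Suc n)) \<longlonglongrightarrow> s - 0"
      by (intro tendsto_diff tendsto_const) (rule LIMSEQ_Suc[OF lim_1_over_n])
    then show "(\<lambda>n. s - 1 / real (Suc n)) \<longlonglongrightarrow> s" by simp
  qed simp
  have "(\<lambda>s. indicator {0..T} s *\<^sub>R f s (V s)) \<in> borel_measurable lborel"
  proof (rule borel_measurable_LIMSEQ_metric)
    fix n
    show "(\<lambda>s. indicator {0..T} s *\<^sub>R f s (V (d n s))) \<in> borel_measurable lborel"
      unfolding d_def
      by (rule measurable_compose_countable[where g = "\<lambda>s. \<lfloor>real (Suc n) * s\<rfloor>"
            and f = "\<lambda>k s. indicator {0..T} s *\<^sub>R f s (V (real_of_int k / real (Suc n)))"])
        (use meas in auto)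
  next
    fix s :: real
    have "(\<lambda>n. V (d n s)) \<longlonglongrightarrow> V s"
      using V d[of s] by (metis UNIV_I continuous_on_eq_continuous_at isCont_tendsto_compose open_UNIV)
    then have "(\<lambda>n. K * norm (V (d n s) - V s)) \<longlonglongrightarrow> 0"
      by (intro tendsto_mult_right_zero tendsto_norm_zero) (simp add: LIM_zero)
    then have "(\<lambda>n. f s (V (d n s)) - f s (V s)) \<longlonglongrightarrow> 0"
      by (rule Lim_null_comparison[rotated]) (simp add: lip)
    then have "(\<lambda>n. f s (V (d n s))) \<longlonglongrightarrow> f s (V s)" by (simp add: LIM_zero_iff)
    then show "(\<lambda>n. indicator {0..T} s *\<^sub>R f s (V (d n s))) \<longlonglongrightarrow> indicator {0..T} s *\<^sub>R f s (V s)"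
      by (intro tendsto_intros)
  qed
  moreover have "(\<lambda>s. indicator {0..T} s *\<^sub>R f s (V s)) = (\<lambda>s. indicator {0..T} s *\<^sub>R f s (v s))"
    by (auto simp: fun_eq_iff V_def indicator_def)
  ultimately have mv: "set_borel_measurable lborel {0..T} (\<lambda>s. f s (v s))"
    by (simp add: set_borel_measurable_def)
  have "bounded (v ` {0..T})" using compact_continuous_image[OF v] by (simp add: compact_imp_bounded)
  then obtain B where B: "\<And>s. s \<in> {0..T} \<Longrightarrow> norm (v s) \<le> B"
    unfolding bounded_iff by blast
  have dom: "set_integrable lborel {0..T} (\<lambda>s. norm (f s 0) + \<bar>K\<bar> * B)"
    using int[of 0] by (intro set_integral_add set_integrable_norm) (auto intro!: borel_integrable_atLeastAtMost' continuous_intros)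
  show ?thesis
  proof (rule set_integrable_bound[OF dom mv], rule AE_I2, rule impI)
    fix s assume s: "s \<in> {0..T}"
    have "norm (f s (v s)) \<le> norm (f s 0) + norm (f s (v s) - f s 0)"
      by (metis add.commute norm_triangle_sub)
    also have "\<dots> \<le> norm (f s 0) + K * norm (v s)" using lip[of s "v s" 0] by simp
    also have "\<dots> \<le> norm (f s 0) + \<bar>K\<bar> * B"
      using B[OF s] by (intro add_left_mono mult_mono) auto
    finally show "norm (f s (v s)) \<le> norm (norm (f s 0) + \<bar>K\<bar> * B)" by simp
  qed
qed

lemma strongly_continuous_imp_jointly_continuous:
  fixes S :: "real \<Rightarrow> 'a::real_normed_vector \<Rightarrow> 'a"
  assumes lin: "\<And>\<tau>. linear (S \<tau>)"
    and bd: "\<And>\<tau> x. norm (S \<tau> x) \<le> M * norm x"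
    and cont: "\<And>x. continuous_on UNIV (\<lambda>\<tau>. S \<tau> x)"
  shows "continuous_on UNIV (\<lambda>z. S (fst z) (snd z))"
  unfolding continuous_on_eq_continuous_at[OF open_UNIV] isCont_def
proof (intro ballI)
  fix z :: "real \<times> 'a"
  have eq: "S (fst y) (snd y) - S (fst z) (snd z)
      = S (fst y) (snd y - snd z) + (S (fst y) (snd z) - S (fst z) (snd z))" for y
    by (simp add: linear_diff[OF lin])
  have "((\<lambda>y. S (fst y) (snd y - snd z)) \<longlongrightarrow> 0) (at z)"
  proof (rule Lim_null_comparison)
    show "\<forall>\<^sub>F y in at z. norm (S (fst y) (snd y - snd z)) \<le> M * norm (snd y - snd z)"
      by (simp add: bd)
    have "((\<lambda>y. M * norm (snd y - snd z)) \<longlongrightarrow> M * norm (snd z - snd z)) (at z)"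
      by (intro tendsto_intros)
    then show "((\<lambda>y. M * norm (snd y - snd z)) \<longlongrightarrow> 0) (at z)" by simp
  qed
  moreover have "((\<lambda>y. S (fst y) (snd z)) \<longlongrightarrow> S (fst z) (snd z)) (at z)"
    using cont[of "snd z"] unfolding continuous_on_eq_continuous_at[OF open_UNIV]
    by (intro isCont_tendsto_compose[where g = "\<lambda>\<tau>. S \<tau> (snd z)"] tendsto_intros) auto
  then have "((\<lambda>y. S (fst y) (snd z) - S (fst z) (snd z)) \<longlongrightarrow> 0) (at z)"
    by (rule LIM_zero)
  ultimately have "((\<lambda>y. S (fst y) (snd y) - S (fst z) (snd z)) \<longlongrightarrow> 0 + 0) (at z)"
    unfolding eq by (rule tendsto_add)
  then show "((\<lambda>y. S (fst y) (snd y)) \<longlongrightarrow> S (fst z) (snd z)) (at z)"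
    by (simp add: LIM_zero_iff)
qed

text \<open>
  The integrand is the jointly continuous map \<open>S\<close> composed with a pair of measurable functions; the
  indicator may be moved inside \<open>S\<close> by linearity.
\<close>

lemma convolution_measurable:
  fixes S :: "real \<Rightarrow> 'a::{banach, second_countable_topology} \<Rightarrow> 'a"
  assumes lin: "\<And>\<tau>. linear (S \<tau>)"
    and bd: "\<And>\<tau> x. norm (S \<tau> x) \<le> M * norm x"
    and cont: "\<And>x. continuous_on UNIV (\<lambda>\<tau>. S \<tau> x)"
    and h: "set_integrable lborel {0..T} h" and t: "t \<in> {0..T}"
  shows "(\<lambda>s. indicator {0..t} s *\<^sub>R S (t - s) (h s)) \<in> borel_measurable lborel"
proof -
  have "(\<lambda>s. indicator {0..t} s *\<^sub>R h s) \<in> borel_measurable lborel"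
    using set_integrable_subset[OF h, of "{0..t}"] t unfolding set_integrable_def by auto
  then have "(\<lambda>s. S (t - s) (indicator {0..t} s *\<^sub>R h s)) \<in> borel_measurable lborel"
    by (rule borel_measurable_continuous_Pair[OF _ _
          strongly_continuous_imp_jointly_continuous[OF lin bd cont], rotated]) simp
  then show ?thesis by (simp add: linear_scale[OF lin])
qed

lemma convolution_set_integrable:
  fixes S :: "real \<Rightarrow> 'a::{banach, second_countable_topology} \<Rightarrow> 'a"
  assumes lin: "\<And>\<tau>. linear (S \<tau>)"
    and bd: "\<And>\<tau> x. norm (S \<tau> x) \<le> M * norm x"
    and cont: "\<And>x. continuous_on UNIV (\<lambda>\<tau>. S \<tau> x)"
    and h: "set_integrable lborel {0..T} h" and t: "t \<in> {0..T}"
  shows "set_integrable lborel {0..t} (\<lambda>s. S (t - s) (h s))"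
proof (rule set_integrable_bound)
  show "set_integrable lborel {0..t} (\<lambda>s. M *\<^sub>R norm (h s))"
    using set_integrable_subset[OF h, of "{0..t}"] t by (intro set_integrable_scaleR_right set_integrable_norm) auto
  show "set_borel_measurable lborel {0..t} (\<lambda>s. S (t - s) (h s))"
    unfolding set_borel_measurable_def by (rule convolution_measurable[OF lin bd cont h t])
  show "AE s in lborel. s \<in> {0..t} \<longrightarrow> norm (S (t - s) (h s)) \<le> norm (M *\<^sub>R norm (h s))"
    by (intro AE_I2 impI) (metis abs_ge_self bd order_trans real_norm_def real_scaleR_def)
qed

text \<open>
  Dominated convergence: for every \<open>s \<noteq> a\<close> the indicators of \<open>{0..r n}\<close> are eventually constant at \<open>s\<close>,
  and the single point \<open>s = a\<close>, where they may oscillate, is a null set.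
\<close>

lemma convolution_continuous_on:
  fixes S :: "real \<Rightarrow> 'a::{banach, second_countable_topology} \<Rightarrow> 'a"
  assumes lin: "\<And>\<tau>. linear (S \<tau>)"
    and bd: "\<And>\<tau> x. norm (S \<tau> x) \<le> M * norm x"
    and cont: "\<And>x. continuous_on UNIV (\<lambda>\<tau>. S \<tau> x)"
    and h: "set_integrable lborel {0..T} h"
  shows "continuous_on {0..T} (\<lambda>t. LBINT s:{0..t}. S (t - s) (h s))"
proof (rule continuous_on_sequentiallyI)
  fix r a assume r: "\<forall>n. r n \<in> {0..T}" and a: "a \<in> {0..T}" and lim: "r \<longlonglongrightarrow> a"
  show "(\<lambda>n. LBINT s:{0..r n}. S (r n - s) (h s)) \<longlonglongrightarrow> (LBINT s:{0..a}. S (a - s) (h s))"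
    unfolding set_lebesgue_integral_def
  proof (rule integral_dominated_convergence)
    show "(\<lambda>s. indicator {0..a} s *\<^sub>R S (a - s) (h s)) \<in> borel_measurable lborel"
      by (rule convolution_measurable[OF lin bd cont h a])
    show "(\<lambda>s. indicator {0..r n} s *\<^sub>R S (r n - s) (h s)) \<in> borel_measurable lborel" for n
      using r by (intro convolution_measurable[OF lin bd cont h]) auto
    show "integrable lborel (\<lambda>s. M * norm (indicator {0..T} s *\<^sub>R h s))"
      using h unfolding set_integrable_def by (intro integrable_mult_right integrable_norm)
    show "AE s in lborel. norm (indicator {0..r n} s *\<^sub>R S (r n - s) (h s))
            \<le> M * norm (indicator {0..T} s *\<^sub>R h s)" for n
    proof (rule AE_I2)
      fix s
      have "r n \<le> T" using r by auto
      have nonneg: "0 \<le> M * norm x" for x :: 'a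
        using norm_ge_zero bd by (rule order_trans)
      then show "norm (indicator {0..r n} s *\<^sub>R S (r n - s) (h s)) \<le> M * norm (indicator {0..T} s *\<^sub>R h s)"
      proof (cases "s \<in> {0..r n}")
        case True
        then have "s \<in> {0..T}" using \<open>r n \<le> T\<close> by auto
        with True show ?thesis using bd[of "r n - s" "h s"] by simp
      qed (use nonneg[of "indicator {0..T} s *\<^sub>R h s"] in simp)
    qed
    show "AE s in lborel. (\<lambda>n. indicator {0..r n} s *\<^sub>R S (r n - s) (h s))
            \<longlonglongrightarrow> indicator {0..a} s *\<^sub>R S (a - s) (h s)"
      using AE_lborel_singleton[of a]
    proof eventually_elim
      fix s assume "s \<noteq> a"
      have "\<forall>\<^sub>F n in sequentially. (indicator {0..r n} s :: real) = indicator {0..a} s"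
      proof (cases "s < a")
        case True
        from order_tendstoD(1)[OF lim True] show ?thesis
          by eventually_elim (use True in \<open>auto simp: indicator_def\<close>)
      next
        case False
        then have "a < s" using \<open>s \<noteq> a\<close> by simp
        from order_tendstoD(2)[OF lim this] show ?thesis
          by eventually_elim (use \<open>a < s\<close> in \<open>auto simp: indicator_def\<close>)
      qed
      then have ind: "(\<lambda>n. indicator {0..r n} s :: real) \<longlonglongrightarrow> indicator {0..a} s"
        by (rule tendsto_eventually)
      have "(\<lambda>n. S (r n - s) (h s)) \<longlonglongrightarrow> S (a - s) (h s)"
        using cont[of "h s"] unfolding continuous_on_eq_continuous_at[OF open_UNIV]
        by (intro isCont_tendsto_compose[where g = "\<lambda>\<tau>. S \<tau> (h s)"] tendsto_intros lim) auto
      with ind show "(\<lambda>n. indicator {0..r n} s *\<^sub>R S (r n - s) (h s))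
            \<longlonglongrightarrow> indicator {0..a} s *\<^sub>R S (a - s) (h s)"
        by (rule tendsto_scaleR)
    qed
  qed
qed

lemma convolution_difference_bound:
  fixes S :: "real \<Rightarrow> 'a::{banach, second_countable_topology} \<Rightarrow> 'a"
  assumes lin: "\<And>\<tau>. linear (S \<tau>)"
    and bd: "\<And>\<tau> x. norm (S \<tau> x) \<le> M * norm x"
    and cont: "\<And>x. continuous_on UNIV (\<lambda>\<tau>. S \<tau> x)"
    and h: "set_integrable lborel {0..T} h" and k: "set_integrable lborel {0..T} k"
    and t: "t \<in> {0..T}" and B: "continuous_on {0..t} B"
    and le: "\<And>s. s \<in> {0..t} \<Longrightarrow> norm (S (t - s) (h s - k s)) \<le> B s"
  shows "norm ((LBINT s:{0..t}. S (t - s) (h s)) - (LBINT s:{0..t}. S (t - s) (k s)))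
           \<le> integral {0..t} B"
proof -
  note conv = convolution_set_integrable[OF lin bd cont _ t]
  have d: "set_integrable lborel {0..t} (\<lambda>s. S (t - s) (h s - k s))"
    by (rule conv) (rule set_integral_diff(1)[OF h k])
  have B': "set_integrable lborel {0..t} B"
    using B by (rule borel_integrable_atLeastAtMost')
  have "(LBINT s:{0..t}. S (t - s) (h s)) - (LBINT s:{0..t}. S (t - s) (k s))
          = (LBINT s:{0..t}. S (t - s) (h s - k s))"
    unfolding linear_diff[OF lin] by (rule set_integral_diff(2)[symmetric, OF conv[OF h] conv[OF k]])
  also have "norm \<dots> \<le> (LBINT s:{0..t}. norm (S (t - s) (h s - k s)))"
    by (rule set_integral_norm_bound[OF d])
  also have "\<dots> \<le> (LBINT s:{0..t}. B s)"
    by (rule set_integral_mono[OF set_integrable_norm[OF d] B']) (rule le)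
  also have "\<dots> = integral {0..t} B"
    by (rule set_borel_integral_eq_integral(2)[OF B'])
  finally show ?thesis .
qed

section \<open>Volterra equations with a Lipschitz source\<close>

text \<open>
  The function \<open>exp (- \<beta> * t) * (a + \<beta> * integral {0..t} Y)\<close> does not increase, since the hypothesis says
  that its derivative is at most \<open>0\<close>, and it starts at \<open>a\<close>.
\<close>

lemma gronwall_integral_inequality:
  fixes Y :: "real \<Rightarrow> real"
  assumes Y: "continuous_on {0..T} Y" and "0 \<le> \<beta>"
    and le: "\<And>t. t \<in> {0..T} \<Longrightarrow> Y t \<le> a + \<beta> * integral {0..t} Y"
    and t: "t \<in> {0..T}"
  shows "Y t \<le> a * exp (\<beta> * t)"
proof -
  \<comment> \<open>negated so that a monotonicity criterion for increasing functions applies\<close>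
  define H where "H = (\<lambda>t. - (exp (- (\<beta> * t)) * (a + \<beta> * integral {0..t} Y)))"
  have "H 0 \<le> H t"
  proof (rule DERIV_nonneg_imp_increasing_open[where a = 0 and b = t and f = H])
    show "0 \<le> t" using t by simp
    show "continuous_on {0..t} H"
      unfolding H_def using t
      by (intro continuous_intros indefinite_integral_continuous_1 integrable_continuous_real
          continuous_on_subset[OF Y]) auto
    fix s assume s: "0 < s" "s < t"
    have "((\<lambda>x. integral {0..x} Y) has_real_derivative Y s) (at s within {0..T})"
      using s t by (intro integral_has_real_derivative Y) auto
    moreover have "at s within {0..T} = at s" using s t by (intro at_within_Icc_at) auto
    ultimately have I: "((\<lambda>x. integral {0..x} Y) has_real_derivative Y s) (at s)" by simp
    have "(H has_real_derivative
        - (exp (- (\<beta> * s)) * (- \<beta>) * (a + \<beta> * integral {0..s} Y) + \<beta> * Y s * exp (- (\<beta> * s)))) (at s)"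
      unfolding H_def by (auto intro!: derivative_eq_intros I)
    moreover have "- (exp (- (\<beta> * s)) * (- \<beta>) * (a + \<beta> * integral {0..s} Y) + \<beta> * Y s * exp (- (\<beta> * s)))
        = \<beta> * exp (- (\<beta> * s)) * (a + \<beta> * integral {0..s} Y - Y s)"
      by (simp add: algebra_simps)
    moreover have "0 \<le> \<beta> * exp (- (\<beta> * s)) * (a + \<beta> * integral {0..s} Y - Y s)"
      using le[of s] s t \<open>0 \<le> \<beta>\<close> by (intro mult_nonneg_nonneg) auto
    ultimately show "\<exists>y. DERIV H s :> y \<and> 0 \<le> y" by metis
  qed
  then have "exp (- (\<beta> * t)) * (a + \<beta> * integral {0..t} Y) \<le> a" by (simp add: H_def)
  then have "exp (\<beta> * t) * (exp (- (\<beta> * t)) * (a + \<beta> * integral {0..t} Y)) \<le> exp (\<beta> * t) * a"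
    by (intro mult_left_mono) auto
  then have "a + \<beta> * integral {0..t} Y \<le> a * exp (\<beta> * t)"
    by (simp add: mult.assoc[symmetric] exp_add[symmetric] mult.commute)
  with le[OF t] show ?thesis by linarith
qed

text \<open>
  The exponential weight of the kernel is multiplicative,
  \<open>exp (\<mu> * (t - s)) * exp (\<mu> * s) = exp (\<mu> * t)\<close>.  After division by \<open>exp (\<mu> * t)\<close> the difference of
  the two solutions therefore satisfies a Gronwall inequality with constant coefficients
  \<open>\<delta>\<close> and \<open>m * K\<close>.  Uniqueness is the case \<open>\<delta> = 0\<close>.
\<close>

lemma volterra_stability:
  fixes S :: "real \<Rightarrow> 'a::{banach, second_countable_topology} \<Rightarrow> 'a"
  assumes lin: "\<And>\<tau>. linear (S \<tau>)"
    and bd: "\<And>\<tau> x. norm (S \<tau> x) \<le> M * norm x"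
    and cont: "\<And>x. continuous_on UNIV (\<lambda>\<tau>. S \<tau> x)"
    and growth: "\<And>\<tau> x. \<tau> \<in> {0..T} \<Longrightarrow> norm (S \<tau> x) \<le> m * exp (\<mu> * \<tau>) * norm x"
    and "0 \<le> m" "0 \<le> K" "0 \<le> T"
    and lip: "\<And>t w v. norm (f t w - f t v) \<le> K * norm (w - v)"
    and int: "\<And>w. set_integrable lborel {0..T} (\<lambda>t. f t w)"
    and v: "continuous_on {0..T} v" "\<And>t. t \<in> {0..T} \<Longrightarrow> v t = b t + (LBINT s:{0..t}. S (t - s) (f s (v s)))"
    and w: "continuous_on {0..T} w" "\<And>t. t \<in> {0..T} \<Longrightarrow> w t = c t + (LBINT s:{0..t}. S (t - s) (f s (w s)))"
    and bc: "\<And>t. t \<in> {0..T} \<Longrightarrow> norm (b t - c t) \<le> \<delta> * exp (\<mu> * t)"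
    and t: "t \<in> {0..T}"
  shows "norm (v t - w t) \<le> \<delta> * exp ((\<mu> + m * K) * t)"
proof -
  define Y where "Y = (\<lambda>t. exp (- (\<mu> * t)) * norm (v t - w t))"
  have Y: "continuous_on {0..T} Y"
    unfolding Y_def by (intro continuous_intros v(1) w(1))
  have "Y t \<le> \<delta> + (m * K) * integral {0..t} Y" if t: "t \<in> {0..T}" for t
  proof -
    let ?B = "\<lambda>s. (m * K * exp (\<mu> * t)) * Y s"
    have Yt: "continuous_on {0..t} Y" using t by (intro continuous_on_subset[OF Y]) auto
    have "norm ((LBINT s:{0..t}. S (t - s) (f s (v s))) - (LBINT s:{0..t}. S (t - s) (f s (w s))))
            \<le> integral {0..t} ?B"
    proof (rule convolution_difference_bound[OF lin bd cont _ _ t])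
      show "set_integrable lborel {0..T} (\<lambda>s. f s (v s))" "set_integrable lborel {0..T} (\<lambda>s. f s (w s))"
        using composition_set_integrable[OF \<open>0 \<le> T\<close> lip int] v(1) w(1) by auto
      show "continuous_on {0..t} ?B" by (intro continuous_intros Yt)
      fix s assume s: "s \<in> {0..t}"
      have "norm (S (t - s) (f s (v s) - f s (w s)))
              \<le> m * exp (\<mu> * (t - s)) * norm (f s (v s) - f s (w s))"
        using s t by (intro growth) auto
      also have "\<dots> \<le> m * exp (\<mu> * (t - s)) * (K * norm (v s - w s))"
        using lip \<open>0 \<le> m\<close> by (intro mult_left_mono) auto
      also have "\<dots> = ?B s"
        by (simp add: Y_def right_diff_distrib exp_diff exp_minus field_simps)
      finally show "norm (S (t - s) (f s (v s) - f s (w s))) \<le> ?B s" .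
    qed
    also have "integral {0..t} ?B = m * K * exp (\<mu> * t) * integral {0..t} Y"
      by (rule integral_mult_right)
    finally have conv: "norm ((LBINT s:{0..t}. S (t - s) (f s (v s))) - (LBINT s:{0..t}. S (t - s) (f s (w s))))
            \<le> m * K * exp (\<mu> * t) * integral {0..t} Y" .
    have "v t - w t = (b t - c t)
        + ((LBINT s:{0..t}. S (t - s) (f s (v s))) - (LBINT s:{0..t}. S (t - s) (f s (w s))))"
      unfolding v(2)[OF t] w(2)[OF t] by (rule add_diff_add)
    then have "norm (v t - w t) \<le> \<delta> * exp (\<mu> * t) + m * K * exp (\<mu> * t) * integral {0..t} Y"
      using norm_triangle_mono[OF bc[OF t] conv] by metis
    then have "exp (- (\<mu> * t)) * norm (v t - w t)
        \<le> exp (- (\<mu> * t)) * (\<delta> * exp (\<mu> * t) + m * K * exp (\<mu> * t) * integral {0..t} Y)"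
      by (intro mult_left_mono) auto
    also have "\<dots> = \<delta> + (m * K) * integral {0..t} Y" by (simp add: exp_minus field_simps)
    finally show ?thesis by (simp add: Y_def)
  qed
  from gronwall_integral_inequality[OF Y _ this t] \<open>0 \<le> m\<close> \<open>0 \<le> K\<close>
  have "exp (- (\<mu> * t)) * norm (v t - w t) \<le> \<delta> * exp (m * K * t)" by (simp add: Y_def)
  then have "exp (\<mu> * t) * (exp (- (\<mu> * t)) * norm (v t - w t)) \<le> exp (\<mu> * t) * (\<delta> * exp (m * K * t))"
    by (intro mult_left_mono) auto
  also have "exp (\<mu> * t) * (exp (- (\<mu> * t)) * norm (v t - w t)) = norm (v t - w t)"
    by (simp add: exp_minus)
  finally show ?thesis by (simp add: distrib_right exp_add mult.left_commute)
qed

text \<open>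
  In the unknown \<open>V t = exp (- L * t) *\<^sub>R v t\<close> the integral operator contracts the supremum norm by
  \<open>M * K / L\<close>, because \<open>integral {0..t} (\<lambda>s. exp (L * s)) \<le> exp (L * t) / L\<close>.  Banach's fixed point theorem
  applies on the complete space of bounded continuous functions on the line, into which functions on
  \<open>{0..T}\<close> are embedded by composition with the retraction \<open>c\<close>.
\<close>

lemma volterra_existence:
  fixes S :: "real \<Rightarrow> 'a::{banach, second_countable_topology} \<Rightarrow> 'a"
  assumes lin: "\<And>\<tau>. linear (S \<tau>)"
    and bd: "\<And>\<tau> x. norm (S \<tau> x) \<le> M * norm x"
    and cont: "\<And>x. continuous_on UNIV (\<lambda>\<tau>. S \<tau> x)"
    and "0 \<le> M" "0 \<le> K" "0 \<le> T"
    and lip: "\<And>t w v. norm (f t w - f t v) \<le> K * norm (w - v)"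
    and int: "\<And>w. set_integrable lborel {0..T} (\<lambda>t. f t w)"
    and b: "continuous_on {0..T} b"
  obtains v where "continuous_on {0..T} v"
    "\<And>t. t \<in> {0..T} \<Longrightarrow> v t = b t + (LBINT s:{0..t}. S (t - s) (f s (v s)))"
proof -
  \<comment> \<open>the factor 2 makes the contraction constant \<open>1 / 2\<close>, the summand 1 keeps \<open>L\<close> positive if \<open>M * K = 0\<close>\<close>
  define L where "L = 2 * (M * K) + 1"
  have L: "L > 0" "M * K / L \<le> 1 / 2" using \<open>0 \<le> M\<close> \<open>0 \<le> K\<close> by (auto simp: L_def field_simps add_pos_nonneg)
  define c where "c = (\<lambda>t. max 0 (min T t))"
  have c: "continuous_on UNIV c" "c t \<in> {0..T}" for t
    using \<open>0 \<le> T\<close> by (auto simp: c_def intro!: continuous_intros)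
  define weighted where "weighted = (\<lambda>(V :: real \<Rightarrow>\<^sub>C 'a) s. exp (L * s) *\<^sub>R V s)"
  have weighted: "continuous_on A (weighted V)" for V A
    unfolding weighted_def by (intro continuous_intros continuous_on_apply_bcontfun)
  have f_int: "set_integrable lborel {0..T} (\<lambda>s. f s (weighted V s))" for V
    by (rule composition_set_integrable[OF \<open>0 \<le> T\<close> lip int weighted])
  define G where "G = (\<lambda>V t. b t + (LBINT s:{0..t}. S (t - s) (f s (weighted V s))))"
  have G: "continuous_on {0..T} (G V)" for V
    unfolding G_def by (intro continuous_intros b convolution_continuous_on[OF lin bd cont f_int])
  define F where "F = (\<lambda>V t. exp (- (L * c t)) *\<^sub>R G V (c t))"
  have F_bcontfun: "F V \<in> bcontfun" for V
  proof -
    have "continuous_on {0..T} (\<lambda>s. exp (- (L * s)) *\<^sub>R G V s)"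
      by (intro continuous_intros G)
    then have "bounded ((\<lambda>s. exp (- (L * s)) *\<^sub>R G V s) ` {0..T})" "continuous_on UNIV (F V)"
      unfolding F_def using c continuous_on_compose2[of "{0..T}" "\<lambda>s. exp (- (L * s)) *\<^sub>R G V s" UNIV c]
      by (auto simp: image_subset_iff intro!: compact_imp_bounded compact_continuous_image)
    moreover have "range (F V) \<subseteq> (\<lambda>s. exp (- (L * s)) *\<^sub>R G V s) ` {0..T}"
      using c(2) by (auto simp: F_def)
    ultimately show ?thesis by (auto simp: bcontfun_def intro: bounded_subset)
  qed
  define \<Phi> where "\<Phi> = (\<lambda>V. Bcontfun (F V))"
  have \<Phi>: "apply_bcontfun (\<Phi> V) = F V" for V
    unfolding \<Phi>_def by (rule Bcontfun_inverse[OF F_bcontfun])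
  have contr: "dist (\<Phi> V) (\<Phi> W) \<le> 1 / 2 * dist V W" for V W
  proof (rule dist_bound)
    fix t
    define \<tau> where "\<tau> = c t"
    have \<tau>: "\<tau> \<in> {0..T}" unfolding \<tau>_def by (rule c)
    let ?B = "\<lambda>s. (M * K * dist V W) * exp (L * s)"
    have "norm (G V \<tau> - G W \<tau>) \<le> integral {0..\<tau>} ?B"
      unfolding G_def add_diff_cancel_left
    proof (rule convolution_difference_bound[OF lin bd cont f_int f_int \<tau>])
      show "continuous_on {0..\<tau>} ?B" by (intro continuous_intros)
      fix s
      have "norm (S (\<tau> - s) (f s (weighted V s) - f s (weighted W s)))
              \<le> M * norm (f s (weighted V s) - f s (weighted W s))" by (rule bd)
      also have "\<dots> \<le> M * (K * norm (weighted V s - weighted W s))"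
        using lip \<open>0 \<le> M\<close> by (intro mult_left_mono) auto
      also have "norm (weighted V s - weighted W s) = exp (L * s) * dist (V s) (W s)"
        by (simp add: weighted_def dist_norm scaleR_diff_right[symmetric])
      also have "M * (K * (exp (L * s) * dist (V s) (W s))) \<le> M * (K * (exp (L * s) * dist V W))"
        using dist_bounded \<open>0 \<le> M\<close> \<open>0 \<le> K\<close> by (intro mult_left_mono) auto
      finally show "norm (S (\<tau> - s) (f s (weighted V s) - f s (weighted W s))) \<le> ?B s"
        by (simp add: algebra_simps)
    qed
    also have "\<dots> = M * K * dist V W * integral {0..\<tau>} (\<lambda>s. exp (L * s))"
      by (rule integral_mult_right)
    also have "integral {0..\<tau>} (\<lambda>s. exp (L * s)) = exp (L * \<tau>) / L - exp (L * 0) / L"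
    proof (rule integral_unique, rule fundamental_theorem_of_calculus)
      show "((\<lambda>s. exp (L * s) / L) has_vector_derivative exp (L * s)) (at s within {0..\<tau>})" for s
        using L unfolding has_real_derivative_iff_has_vector_derivative[symmetric]
        by (auto intro!: derivative_eq_intros)
    qed (use \<tau> in auto)
    also have "M * K * dist V W * (exp (L * \<tau>) / L - exp (L * 0) / L)
        \<le> M * K * dist V W * (exp (L * \<tau>) / L)"
      using L \<open>0 \<le> M\<close> \<open>0 \<le> K\<close> by (intro mult_left_mono) auto
    also have "\<dots> = exp (L * \<tau>) * (M * K / L * dist V W)" by simp
    also have "\<dots> \<le> exp (L * \<tau>) * (1 / 2 * dist V W)"
      using L by (intro mult_left_mono mult_right_mono) auto
    finally have G_le: "norm (G V \<tau> - G W \<tau>) \<le> exp (L * \<tau>) * (1 / 2 * dist V W)" .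
    have "dist (F V t) (F W t) = exp (- (L * \<tau>)) * norm (G V \<tau> - G W \<tau>)"
      by (simp add: F_def \<tau>_def dist_norm scaleR_diff_right[symmetric])
    also have "\<dots> \<le> exp (- (L * \<tau>)) * (exp (L * \<tau>) * (1 / 2 * dist V W))"
      using G_le by (intro mult_left_mono) auto
    also have "\<dots> = 1 / 2 * dist V W" by (simp add: exp_minus)
    finally show "dist (\<Phi> V t) (\<Phi> W t) \<le> 1 / 2 * dist V W" by (simp add: \<Phi>)
  qed
  have "\<exists>!V. \<Phi> V = V"
    by (rule banach_fix_type[where c = "1 / 2"]) (use contr in auto)
  then obtain V where V: "\<Phi> V = V" by blast
  have "weighted V t = G V t" if "t \<in> {0..T}" for t
  proof -
    have "c t = t" using that by (auto simp: c_def)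
    then have "V t = exp (- (L * t)) *\<^sub>R G V t" using \<Phi>[of V] V by (simp add: F_def)
    then show ?thesis by (simp add: weighted_def exp_minus)
  qed
  then show thesis using that[OF weighted[of _ V]] by (simp add: G_def)
qed

section \<open>Single modes of the exact solution\<close>

lemma set_integrable_continuous_mult:
  fixes h k :: "real \<Rightarrow> real"
  assumes h: "set_integrable lborel {a..b} h" and k: "continuous_on {a..b} k"
  shows "set_integrable lborel {a..b} (\<lambda>s. k s * h s)"
proof -
  have "bounded (k ` {a..b})" using compact_continuous_image[OF k] by (simp add: compact_imp_bounded)
  then obtain B where B: "\<And>s. s \<in> {a..b} \<Longrightarrow> \<bar>k s\<bar> \<le> B"
    unfolding bounded_iff by (metis image_eqI real_norm_def)
  have "(\<lambda>s. indicator {a..b} s *\<^sub>R k s) \<in> borel_measurable lborel"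
    using borel_integrable_atLeastAtMost'[OF k] unfolding set_integrable_def
    by (rule borel_measurable_integrable)
  moreover have "(\<lambda>s. indicator {a..b} s *\<^sub>R h s) \<in> borel_measurable lborel"
    using h unfolding set_integrable_def by (rule borel_measurable_integrable)
  ultimately have "(\<lambda>s. (indicator {a..b} s *\<^sub>R k s) * (indicator {a..b} s *\<^sub>R h s)) \<in> borel_measurable lborel"
    by (rule borel_measurable_times)
  moreover have "(\<lambda>s. (indicator {a..b} s *\<^sub>R k s) * (indicator {a..b} s *\<^sub>R h s))
      = (\<lambda>s. indicator {a..b} s *\<^sub>R (k s * h s))"
    by (auto simp: fun_eq_iff indicator_def)
  ultimately have m: "set_borel_measurable lborel {a..b} (\<lambda>s. k s * h s)"
    by (simp add: set_borel_measurable_def)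
  have d: "set_integrable lborel {a..b} (\<lambda>s. B * \<bar>h s\<bar>)"
    using set_integrable_norm[OF h] by (intro set_integrable_mult_right) simp
  show ?thesis
  proof (rule set_integrable_bound[OF d m], rule AE_I2, rule impI)
    fix s assume "s \<in> {a..b}"
    then have "\<bar>k s\<bar> * \<bar>h s\<bar> \<le> \<bar>B\<bar> * \<bar>h s\<bar>"
      using B[of s] by (intro mult_right_mono) linarith+
    then show "norm (k s * h s) \<le> norm (B * \<bar>h s\<bar>)" by (simp add: abs_mult)
  qed
qed

text \<open>
  The fundamental theorem of calculus is not enough here: \<open>h\<close> is only integrable, and the derivative is
  claimed at every point.  The kernel \<open>k \<tau> = sinh (q * max 0 \<tau>)\<close> is Lipschitz on \<open>{..T}\<close> and
  differentiable off \<open>0\<close>, because \<open>sinh\<close> vanishes at \<open>0\<close>.  So the difference quotients of the convolution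
  converge by dominated convergence, the exceptional point \<open>s = t\<close> being a null set.
\<close>

lemma sinh_convolution_has_derivative:
  fixes h :: "real \<Rightarrow> real"
  assumes h: "set_integrable lborel {0..T} h" and q: "0 \<le> q" and t: "t \<in> {0..T}"
  shows "((\<lambda>t. LBINT s:{0..t}. sinh (q * (t - s)) * h s) has_real_derivative
            q * (LBINT s:{0..t}. cosh (q * (t - s)) * h s)) (at t within {0..T})"
proof -
  define k where "k = (\<lambda>\<tau>. sinh (q * max 0 \<tau>))"
  define k' where "k' = (\<lambda>\<tau>. if \<tau> > 0 then q * cosh (q * \<tau>) else 0)"
  define g where "g = (\<lambda>s. indicator {0..T} s * h s)"
  define L where "L = q * cosh (q * T)"
  have g: "integrable lborel g" using h by (simp add: g_def set_integrable_def)
  have "L \<ge> 0" using q cosh_real_pos[of "q * T"] by (simp add: L_def)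
  have lip: "\<bar>k x - k y\<bar> \<le> L * \<bar>x - y\<bar>" if "x \<le> T" "y \<le> T" for x y
  proof -
    have "norm (k x - k y) \<le> L * norm (max 0 x - max 0 y)"
      unfolding k_def
    proof (rule field_differentiable_bound[where S = "{0..T}" and f' = "\<lambda>\<tau>. q * cosh (q * \<tau>)"])
      show "((\<lambda>\<tau>. sinh (q * \<tau>)) has_field_derivative q * cosh (q * \<tau>)) (at \<tau> within {0..T})" for \<tau>
        by (auto intro!: derivative_eq_intros)
      show "norm (q * cosh (q * \<tau>)) \<le> L" if "\<tau> \<in> {0..T}" for \<tau>
        using that q unfolding L_def
        by (auto simp: abs_mult intro!: mult_left_mono cosh_real_nonneg_le_iff[THEN iffD2])
    qed (use that t in auto)
    also have "\<dots> \<le> L * \<bar>x - y\<bar>" using \<open>L \<ge> 0\<close> by (intro mult_left_mono) auto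
    finally show ?thesis by simp
  qed
  have deriv: "(k has_real_derivative k' \<tau>) (at \<tau>)" if "\<tau> \<noteq> 0" for \<tau>
  proof (cases "\<tau> > 0")
    case True
    have "((\<lambda>\<tau>. sinh (q * \<tau>)) has_real_derivative k' \<tau>) (at \<tau>)"
      using True by (auto simp: k'_def intro!: derivative_eq_intros)
    then show ?thesis
      by (rule has_field_derivative_transform_within_open[where S = "{0<..}"])
        (use True in \<open>auto simp: k_def\<close>)
  next
    case False
    then have "\<tau> < 0" using that by simp
    have "((\<lambda>\<tau>. 0) has_real_derivative k' \<tau>) (at \<tau>)" using False by (simp add: k'_def)
    then show ?thesis
      by (rule has_field_derivative_transform_within_open[where S = "{..<0}"])
        (use \<open>\<tau> < 0\<close> in \<open>auto simp: k_def\<close>)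
  qed
  have "continuous_on UNIV k"
    unfolding k_def by (intro continuous_intros)
  then have k_meas[measurable]: "k \<in> borel_measurable borel" by (rule borel_measurable_continuous_onI)
  have k'_meas[measurable]: "k' \<in> borel_measurable borel"
    unfolding k'_def cosh_def by measurable
  have g_meas[measurable]: "g \<in> borel_measurable borel"
    using borel_measurable_integrable[OF g] by simp
  \<comment> \<open>extending the kernel by zero removes \<open>t\<close> from the domain of integration\<close>
  have conv: "(LBINT s:{0..r}. sinh (q * (r - s)) * h s) = (LINT s|lborel. k (r - s) * g s)"
    if "r \<in> {0..T}" for r
    unfolding set_lebesgue_integral_def using that
    by (intro Bochner_Integration.integral_cong) (auto simp: k_def g_def indicator_def max_def)
  have int: "integrable lborel (\<lambda>s. k (r - s) * g s)" if "r \<in> {0..T}" for r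
  proof (rule Bochner_Integration.integrable_bound)
    show "integrable lborel (\<lambda>s. (L * T) * g s)" by (intro integrable_mult_right g)
    have "\<bar>k (r - s) * g s\<bar> \<le> \<bar>(L * T) * g s\<bar>" for s
    proof (cases "s \<in> {0..T}")
      case True
      then have "\<bar>k (r - s) - k 0\<bar> \<le> L * \<bar>max 0 (r - s) - 0\<bar>"
        using lip[of "max 0 (r - s)" 0] that by (simp add: k_def)
      also have "\<dots> \<le> L * T" using True that \<open>L \<ge> 0\<close> by (intro mult_left_mono) auto
      finally have "\<bar>k (r - s)\<bar> \<le> \<bar>L * T\<bar>" by (simp add: k_def)
      then show ?thesis unfolding abs_mult[of _ "g s"] by (rule mult_right_mono) simp
    qed (simp add: g_def)
    then show "AE s in lborel. norm (k (r - s) * g s) \<le> norm ((L * T) * g s)" by simp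
  qed simp
  have conv': "q * (LBINT s:{0..t}. cosh (q * (t - s)) * h s) = (LINT s|lborel. k' (t - s) * g s)"
  proof -
    have "q * (LBINT s:{0..t}. cosh (q * (t - s)) * h s)
        = (LINT s|lborel. indicator {0..t} s *\<^sub>R (q * (cosh (q * (t - s)) * h s)))"
      unfolding set_lebesgue_integral_def by (subst integral_mult_right_zero[symmetric]) (simp add: algebra_simps)
    also have "\<dots> = (LINT s|lborel. k' (t - s) * g s)"
    proof (rule integral_cong_AE)
      have "(\<lambda>s. q * cosh (q * (t - s)) * g s) \<in> borel_measurable lborel"
        unfolding cosh_def by measurable
      moreover have "(\<lambda>s. indicator {0..t} s *\<^sub>R (q * (cosh (q * (t - s)) * h s)))
          = (\<lambda>s. indicator {0..t} s * (q * cosh (q * (t - s)) * g s))"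
        using t by (auto simp: g_def fun_eq_iff indicator_def)
      ultimately show "(\<lambda>s. indicator {0..t} s *\<^sub>R (q * (cosh (q * (t - s)) * h s))) \<in> borel_measurable lborel"
        by simp
      show "AE s in lborel. indicator {0..t} s *\<^sub>R (q * (cosh (q * (t - s)) * h s)) = k' (t - s) * g s"
        using AE_lborel_singleton[of t] t
        by (auto elim!: eventually_mono simp: k'_def g_def indicator_def)
    qed simp
    finally show ?thesis .
  qed
  show ?thesis
    unfolding has_field_derivative_iff conv' tendsto_at_iff_sequentially
  proof (intro allI impI)
    fix r assume r: "\<forall>n. r n \<in> {0..T} - {t}" and lim: "r \<longlonglongrightarrow> t"
    have "(\<lambda>n. LINT s|lborel. (k (r n - s) - k (t - s)) / (r n - t) * g s)
        \<longlonglongrightarrow> (LINT s|lborel. k' (t - s) * g s)"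
    proof (rule integral_dominated_convergence)
      show "integrable lborel (\<lambda>s. L * \<bar>g s\<bar>)" using g by (intro integrable_mult_right integrable_abs)
      show "AE s in lborel. norm ((k (r n - s) - k (t - s)) / (r n - t) * g s) \<le> L * \<bar>g s\<bar>" for n
      proof (rule AE_I2)
        fix s
        show "norm ((k (r n - s) - k (t - s)) / (r n - t) * g s) \<le> L * \<bar>g s\<bar>"
        proof (cases "s \<in> {0..T}")
          case True
          have rn: "r n \<noteq> t" "r n \<in> {0..T}" using r by auto
          have "\<bar>k (r n - s) - k (t - s)\<bar> \<le> L * \<bar>r n - t\<bar>"
            using lip[of "r n - s" "t - s"] True t rn by auto
          then have "\<bar>(k (r n - s) - k (t - s)) / (r n - t)\<bar> \<le> L"
            using rn by (simp add: abs_divide divide_le_eq)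
          then show ?thesis unfolding real_norm_def abs_mult[of _ "g s"] by (rule mult_right_mono) simp
        qed (simp add: g_def)
      qed
      show "AE s in lborel. (\<lambda>n. (k (r n - s) - k (t - s)) / (r n - t) * g s) \<longlonglongrightarrow> k' (t - s) * g s"
        using AE_lborel_singleton[of t]
      proof eventually_elim
        fix s assume "s \<noteq> t"
        then have "(k has_real_derivative k' (t - s)) (at (t - s))" by (intro deriv) simp
        moreover have "((\<lambda>x. x - s) has_real_derivative 1) (at t)" by (auto intro!: derivative_eq_intros)
        ultimately have "((\<lambda>x. k (x - s)) has_real_derivative k' (t - s)) (at t)"
          using DERIV_chain2[where f = k and g = "\<lambda>x. x - s" and x = t and s = UNIV
              and Da = "k' (t - s)" and Db = 1] by simp
        then have "(\<lambda>n. (k (r n - s) - k (t - s)) / (r n - t)) \<longlonglongrightarrow> k' (t - s)"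
          unfolding has_field_derivative_iff tendsto_at_iff_sequentially using r lim by (simp add: comp_def)
        then show "(\<lambda>n. (k (r n - s) - k (t - s)) / (r n - t) * g s) \<longlonglongrightarrow> k' (t - s) * g s"
          by (intro tendsto_mult_right)
      qed
    qed simp_all
    moreover have "(LINT s|lborel. (k (r n - s) - k (t - s)) / (r n - t) * g s)
        = ((LBINT s:{0..r n}. sinh (q * (r n - s)) * h s) - (LBINT s:{0..t}. sinh (q * (t - s)) * h s)) / (r n - t)" for n
    proof -
      have rn: "r n \<in> {0..T}" using r by auto
      have "(LINT s|lborel. (k (r n - s) - k (t - s)) / (r n - t) * g s)
          = (LINT s|lborel. (k (r n - s) * g s - k (t - s) * g s) / (r n - t))"
        by (simp add: left_diff_distrib)
      also have "\<dots> = ((LINT s|lborel. k (r n - s) * g s) - (LINT s|lborel. k (t - s) * g s)) / (r n - t)"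
        using int[OF rn] int[OF t] by simp
      finally show ?thesis by (simp add: conv[OF rn] conv[OF t])
    qed
    ultimately show "((\<lambda>y. ((LBINT s:{0..y}. sinh (q * (y - s)) * h s)
          - (LBINT s:{0..t}. sinh (q * (t - s)) * h s)) / (y - t)) \<circ> r) \<longlonglongrightarrow> (LINT s|lborel. k' (t - s) * g s)"
      by (simp only: comp_def)
  qed
qed

text \<open>
  Split every hyperbolic function into exponentials.  The regularized and the exact formula differ only
  in the factor \<open>Q\<close> of the growing exponentials, and these are isolated by \<open>y + y' / sqrt l\<close>: the
  derivative changes the sign of the decaying exponentials relative to the growing ones.
\<close>

lemma mode_residual:
  fixes h y :: "real \<Rightarrow> real"
  assumes "0 < l" "0 < T" and h: "set_integrable lborel {0..T} h"
    and y: "\<And>t. t \<in> {0..T} \<Longrightarrow> y t = cosh (sqrt l * t) * a + sinh (sqrt l * t) / sqrt l * b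
              + (LBINT s:{0..t}. sinh (sqrt l * (t - s)) / sqrt l * h s)"
    and y': "(y has_real_derivative y') (at t within {0..T})" and t: "t \<in> {0..T}"
  shows "y t - (cosh_reg T \<epsilon> l t * a + sinh_reg T \<epsilon> l t / sqrt l * b
              + (LBINT s:{0..t}. sinh_reg T \<epsilon> l (t - s) / sqrt l * h s))
         = (1 - Q_reg T \<epsilon> l) / 2 * (y t + y' / sqrt l)"
proof -
  define q where "q = sqrt l"
  have q: "q > 0" using \<open>0 < l\<close> by (simp add: q_def)
  define Q where "Q = Q_reg T \<epsilon> l"
  have int: "set_integrable lborel {0..t} (\<lambda>s. k s * h s)" if "continuous_on {0..t} k" for k
    using that t set_integrable_subset[OF h, of "{0..t}"] by (intro set_integrable_continuous_mult) auto
  define ep em where "ep = (LBINT s:{0..t}. exp (q * (t - s)) * h s)"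
    and "em = (LBINT s:{0..t}. exp (- (q * (t - s))) * h s)"
  have combine: "(LBINT s:{0..t}. (c * exp (q * (t - s)) + d * exp (- (q * (t - s)))) * h s) = c * ep + d * em" for c d
  proof -
    have "(LBINT s:{0..t}. (c * exp (q * (t - s)) + d * exp (- (q * (t - s)))) * h s)
        = (LBINT s:{0..t}. c * (exp (q * (t - s)) * h s) + d * (exp (- (q * (t - s))) * h s))"
      by (simp add: algebra_simps)
    also have "\<dots> = (LBINT s:{0..t}. c * (exp (q * (t - s)) * h s)) + (LBINT s:{0..t}. d * (exp (- (q * (t - s))) * h s))"
      by (intro set_integral_add(2) set_integrable_mult_right int continuous_intros)
    finally show ?thesis by (simp add: ep_def em_def)
  qed
  have sinh_int: "(LBINT s:{0..t}. sinh (q * (t - s)) / q * h s) = (ep - em) / (2 * q)"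
    using combine[of "1 / (2 * q)" "- 1 / (2 * q)"] q
    by (simp add: sinh_field_def field_simps)
  have cosh_int: "(LBINT s:{0..t}. cosh (q * (t - s)) * h s) = (ep + em) / 2"
    using combine[of "1 / 2" "1 / 2"] by (simp add: cosh_field_def field_simps)
  have reg_int: "(LBINT s:{0..t}. sinh_reg T \<epsilon> l (t - s) / q * h s) = (Q * ep - em) / (2 * q)"
    using combine[of "Q / (2 * q)" "- 1 / (2 * q)"] q
    by (simp add: sinh_reg_def Q_def q_def[symmetric] field_simps)
  have D: "((\<lambda>t. cosh (q * t) * a + sinh (q * t) / q * b + (LBINT s:{0..t}. sinh (q * (t - s)) * h s) / q)
      has_real_derivative q * sinh (q * t) * a + cosh (q * t) * b + q * ((ep + em) / 2) / q) (at t within {0..T})"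
    using q sinh_convolution_has_derivative[OF h less_imp_le[OF q] t] unfolding cosh_int
    by (auto intro!: derivative_eq_intros)
  have y_eq: "y r = cosh (q * r) * a + sinh (q * r) / q * b + (LBINT s:{0..r}. sinh (q * (r - s)) * h s) / q"
    if "r \<in> {0..T}" for r
    using y[OF that] by (simp add: q_def[symmetric])
  have "(y has_real_derivative q * sinh (q * t) * a + cosh (q * t) * b + q * ((ep + em) / 2) / q) (at t within {0..T})"
    by (rule has_field_derivative_transform_within[OF D zero_less_one t]) (simp add: y_eq)
  then have y'_eq: "y' = q * sinh (q * t) * a + cosh (q * t) * b + q * ((ep + em) / 2) / q"
    using y' \<open>0 < T\<close> t unfolding has_real_derivative_iff_has_vector_derivative box_real[symmetric]
    by (intro vector_derivative_unique_within_closed_interval[of 0 T t y])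
  \<comment> \<open>absorbing the divisions by \<open>q\<close> leaves a polynomial identity\<close>
  define X Z B E M where "X = exp (q * t)" and "Z = exp (- (q * t))"
    and "B = b / q" and "E = ep / q" and "M = em / q"
  have y_t: "y t = (X + Z) / 2 * a + (X - Z) / 2 * B + (E - M) / 2"
    unfolding y[OF t, folded q_def] sinh_int using q
    by (simp add: X_def Z_def B_def E_def M_def cosh_field_def sinh_field_def field_simps)
  have y'_t: "y' / q = (X - Z) / 2 * a + (X + Z) / 2 * B + (E + M) / 2"
    using q by (simp add: y'_eq X_def Z_def B_def E_def M_def cosh_field_def sinh_field_def field_simps)
  have reg_t: "cosh_reg T \<epsilon> l t * a + sinh_reg T \<epsilon> l t / q * b
      + (LBINT s:{0..t}. sinh_reg T \<epsilon> l (t - s) / q * h s)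
      = (Q * X + Z) / 2 * a + (Q * X - Z) / 2 * B + (Q * E - M) / 2"
    unfolding reg_int unfolding cosh_reg_def sinh_reg_def q_def[symmetric] Q_def[symmetric] using q
    by (simp add: X_def Z_def B_def E_def M_def field_simps)
  show ?thesis
    unfolding q_def[symmetric] Q_def[symmetric] reg_t y'_t unfolding y_t by (simp add: field_simps)
qed

section \<open>Bounds on the filter\<close>

text \<open>
  With \<open>x = exp (- (sqrt l * T))\<close> and \<open>\<theta> = \<tau> / T\<close> this is the interpolation inequality
  \<open>x powr (1 - \<theta>) * \<epsilon> powr \<theta> \<le> \<epsilon> + x\<close>.  The left-hand side is at most the larger of \<open>x\<close> and \<open>\<epsilon>\<close>; the case
  distinction is which of the two that is, as \<open>\<epsilon> = exp (- (\<mu> * T))\<close>.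
\<close>

lemma Q_reg_exp_bound:
  assumes T: "0 < T" and \<epsilon>: "0 < \<epsilon>" "\<epsilon> < 1" and \<tau>: "\<tau> \<in> {0..T}"
  shows "Q_reg T \<epsilon> l * exp (sqrt l * \<tau>) \<le> exp (ln (1 / \<epsilon>) / T * \<tau>)"
proof -
  define q \<mu> where "q = sqrt l" and "\<mu> = ln (1 / \<epsilon>) / T"
  have \<epsilon>_eq: "\<epsilon> = exp (- (\<mu> * T))" using T \<epsilon> by (simp add: \<mu>_def ln_div)
  have "exp (- (q * T)) * exp (q * \<tau>) \<le> exp (\<mu> * \<tau>) * (\<epsilon> + exp (- (q * T)))"
  proof (cases "q \<le> \<mu>")
    case True
    then have "exp (q * \<tau>) \<le> exp (\<mu> * \<tau>)" using \<tau> by (auto intro: mult_right_mono)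
    then have "exp (- (q * T)) * exp (q * \<tau>) \<le> exp (- (q * T)) * exp (\<mu> * \<tau>)"
      by (intro mult_left_mono) auto
    also have "\<dots> \<le> exp (\<mu> * \<tau>) * (\<epsilon> + exp (- (q * T)))" using \<epsilon> by (simp add: distrib_left)
    finally show ?thesis .
  next
    case False
    then have "\<mu> * (T - \<tau>) \<le> q * (T - \<tau>)" using \<tau> by (intro mult_right_mono) auto
    then have "exp (- (q * (T - \<tau>))) \<le> exp (- (\<mu> * (T - \<tau>)))" by simp
    then have "exp (- (q * T)) * exp (q * \<tau>) \<le> exp (\<mu> * \<tau>) * \<epsilon>"
      unfolding \<epsilon>_eq exp_add[symmetric] by (simp add: algebra_simps)
    also have "\<dots> \<le> exp (\<mu> * \<tau>) * (\<epsilon> + exp (- (q * T)))" by (intro mult_left_mono) auto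
    finally show ?thesis .
  qed
  moreover have "0 < \<epsilon> + exp (- (q * T))" using \<epsilon> by (simp add: add_pos_pos)
  ultimately show ?thesis
    by (simp add: Q_reg_def q_def[symmetric] \<mu>_def[symmetric] pos_divide_le_eq)
qed

lemma Q_reg_pos: "0 < \<epsilon> \<Longrightarrow> 0 < Q_reg T \<epsilon> l"
  by (simp add: Q_reg_def add_pos_pos)

lemma exp_decay_le_growth:
  assumes "0 < T" "0 < \<epsilon>" "\<epsilon> < 1" "0 \<le> l" "0 \<le> \<tau>"
  shows "exp (- (sqrt l * \<tau>)) \<le> exp (ln (1 / \<epsilon>) / T * \<tau>)"
proof -
  have "0 \<le> sqrt l * \<tau>" "0 \<le> ln (1 / \<epsilon>) / T * \<tau>"
    using assms by (auto intro!: mult_nonneg_nonneg divide_nonneg_nonneg ln_ge_zero simp del: ln_div)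
  then show ?thesis by simp
qed

lemma abs_half_sum_le:
  fixes a b c :: real
  assumes "0 < a" "0 < b" "b \<le> c" "a \<le> c"
  shows "\<bar>(a + b) / 2\<bar> \<le> c"
  unfolding abs_le_iff using assms by (auto simp: field_simps)

lemma abs_half_diff_le:
  fixes a b c :: real
  assumes "0 < a" "0 < b" "b \<le> c" "a \<le> c"
  shows "\<bar>(a - b) / 2\<bar> \<le> c / 2"
  unfolding abs_le_iff using assms by (auto simp: field_simps)

lemma cosh_reg_bound:
  assumes "0 < T" "0 < \<epsilon>" "\<epsilon> < 1" "0 \<le> l" "\<tau> \<in> {0..T}"
  shows "\<bar>cosh_reg T \<epsilon> l \<tau>\<bar> \<le> exp (ln (1 / \<epsilon>) / T * \<tau>)"
proof -
  have "0 < Q_reg T \<epsilon> l * exp (sqrt l * \<tau>)" using Q_reg_pos[OF assms(2)] by simp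
  moreover have "0 < exp (- (sqrt l * \<tau>))" by simp
  moreover have "exp (- (sqrt l * \<tau>)) \<le> exp (ln (1 / \<epsilon>) / T * \<tau>)"
    using assms by (intro exp_decay_le_growth) auto
  moreover note Q_reg_exp_bound[OF assms(1-3,5), of l]
  ultimately show ?thesis
    unfolding cosh_reg_def by (intro abs_half_sum_le)
qed

lemma sinh_reg_bound:
  assumes "0 < T" "0 < \<epsilon>" "\<epsilon> < 1" "0 \<le> l" "\<tau> \<in> {0..T}"
  shows "\<bar>sinh_reg T \<epsilon> l \<tau>\<bar> \<le> exp (ln (1 / \<epsilon>) / T * \<tau>) / 2"
proof -
  have "0 < Q_reg T \<epsilon> l * exp (sqrt l * \<tau>)" using Q_reg_pos[OF assms(2)] by simp
  moreover have "0 < exp (- (sqrt l * \<tau>))" by simp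
  moreover have "exp (- (sqrt l * \<tau>)) \<le> exp (ln (1 / \<epsilon>) / T * \<tau>)"
    using assms by (intro exp_decay_le_growth) auto
  moreover note Q_reg_exp_bound[OF assms(1-3,5), of l]
  ultimately show ?thesis
    unfolding sinh_reg_def by (intro abs_half_diff_le)
qed

text \<open>
  The defect \<open>1 - Q = \<epsilon> / (\<epsilon> + x)\<close> equals \<open>\<epsilon> * Q * exp (sqrt l * T)\<close>, so the bound on the filtered
  exponential at time \<open>t\<close> applies to it and leaves the weight \<open>exp (sqrt l * (T - t))\<close>.
\<close>

lemma filter_defect_bound:
  assumes "0 < T" "0 < \<epsilon>" "\<epsilon> < 1" "t \<in> {0..T}"
  shows "1 - Q_reg T \<epsilon> l \<le> \<epsilon> * exp (ln (1 / \<epsilon>) / T * t) * exp (sqrt l * (T - t))"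
    and "0 \<le> 1 - Q_reg T \<epsilon> l"
proof -
  define x where "x = exp (- (sqrt l * T))"
  have x: "x > 0" by (simp add: x_def)
  have "1 - Q_reg T \<epsilon> l = \<epsilon> / (\<epsilon> + x)"
    unfolding Q_reg_def x_def[symmetric] using assms x by (simp add: field_simps add_pos_pos)
  also have "\<dots> = \<epsilon> * (Q_reg T \<epsilon> l * exp (sqrt l * t)) * exp (sqrt l * (T - t))"
  proof -
    have "Q_reg T \<epsilon> l * exp (sqrt l * t) * exp (sqrt l * (T - t)) = x * exp (sqrt l * T) / (\<epsilon> + x)"
      by (simp add: Q_reg_def x_def mult.assoc exp_add[symmetric] right_diff_distrib)
    also have "x * exp (sqrt l * T) = 1" by (simp add: x_def exp_minus)
    finally show ?thesis by (simp add: mult.assoc)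
  qed
  also have "\<dots> \<le> \<epsilon> * exp (ln (1 / \<epsilon>) / T * t) * exp (sqrt l * (T - t))"
    using assms by (intro mult_left_mono mult_right_mono Q_reg_exp_bound) auto
  finally show "1 - Q_reg T \<epsilon> l \<le> \<epsilon> * exp (ln (1 / \<epsilon>) / T * t) * exp (sqrt l * (T - t))" .
  show "0 \<le> 1 - Q_reg T \<epsilon> l"
    unfolding Q_reg_def x_def[symmetric] using assms x by (simp add: divide_le_eq_1 add_pos_pos)
qed

section \<open>The error constant and the cut-off time\<close>

text \<open>
  With \<open>a = K * T / sqrt l\<close> and \<open>b = 1 / sqrt l\<close> both summands are compared separately.  Completing
  squares gives \<open>a / 2 \<le> a\<^sup>2 + 1\<close> and \<open>a / 2 \<le> 3 * a\<^sup>2 / 2 + 1 / 24\<close>, and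
  \<open>(1 + b / 2)\<^sup>2 \<le> 5 / 4 * (1 + b\<^sup>2)\<close>; the numerical losses \<open>exp 1 \<le> 4\<close> and \<open>exp (1 / 12) \<le> 12 / 5\<close> fit
  into the factors \<open>2 / (1 / 2)\<close> and \<open>3 / (5 / 4)\<close> available in the constant.
\<close>

lemma error_const_dominates:
  assumes "0 \<le> T" "0 \<le> K" "0 < l" "0 \<le> P"
  shows "(1 + 1 / (2 * sqrt l) + P / 2) * exp (K / (2 * sqrt l) * T) \<le> error_const T K l P"
proof -
  define a b where "a = K * T / sqrt l" and "b = 1 / sqrt l"
  have ab: "a\<^sup>2 = K\<^sup>2 * T\<^sup>2 / l" "b\<^sup>2 = 1 / l" "0 \<le> b"
    using assms by (auto simp: a_def b_def power_divide power_mult_distrib)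
  have "P / 2 * exp (a / 2) \<le> 2 * P * exp (a\<^sup>2)"
  proof -
    have "(a - 1 / 4)\<^sup>2 = a\<^sup>2 - a / 2 + 1 / 16" by (simp add: power2_eq_square algebra_simps)
    then have "a / 2 \<le> a\<^sup>2 + 1" using zero_le_power2[of "a - 1 / 4"] by linarith
    then have "exp (a / 2) \<le> exp (a\<^sup>2) * exp 1" unfolding exp_add[symmetric] by simp
    also have "\<dots> \<le> exp (a\<^sup>2) * 4" using exp_le by (intro mult_left_mono) auto
    finally have "P / 2 * exp (a / 2) \<le> P / 2 * (exp (a\<^sup>2) * 4)"
      using assms by (intro mult_left_mono) auto
    then show ?thesis by simp
  qed
  moreover have "(1 + b / 2) * exp (a / 2) \<le> sqrt (3 * (1 + b\<^sup>2)) * exp (3 * a\<^sup>2 / 2)"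
  proof -
    have "0 \<le> (a - 1 / 6)\<^sup>2" by simp
    then have "a / 2 \<le> 1 / 24 + 3 * a\<^sup>2 / 2" by (simp add: power2_diff power2_eq_square field_simps)
    then have "exp (a / 2) \<le> exp (1 / 24) * exp (3 * a\<^sup>2 / 2)" unfolding exp_add[symmetric] by simp
    then have "(1 + b / 2) * exp (a / 2) \<le> (1 + b / 2) * (exp (1 / 24) * exp (3 * a\<^sup>2 / 2))"
      using ab by (intro mult_left_mono) auto
    also have "\<dots> = ((1 + b / 2) * exp (1 / 24)) * exp (3 * a\<^sup>2 / 2)" by simp
    also have "(1 + b / 2) * exp (1 / 24) \<le> sqrt (3 * (1 + b\<^sup>2))"
    proof (rule real_le_rsqrt)
      have "exp (1 / 24) ^ 2 = exp (1 / 12 :: real)" by (simp add: power2_eq_square exp_add[symmetric])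
      also have "\<dots> \<le> 1 + 1 / 12 + (1 / 12)\<^sup>2" by (rule exp_bound) auto
      also have "\<dots> \<le> 12 / (5 :: real)" by (simp add: power2_eq_square)
      finally have e: "exp (1 / 24) ^ 2 \<le> 12 / (5 :: real)" .
      have "0 \<le> (b - 1 / 2)\<^sup>2" by simp
      then have "(1 + b / 2)\<^sup>2 \<le> 5 / 4 * (1 + b\<^sup>2)" by (simp add: power2_diff power2_sum field_simps)
      then have "(1 + b / 2)\<^sup>2 * exp (1 / 24) ^ 2 \<le> (5 / 4 * (1 + b\<^sup>2)) * (12 / 5)"
        using e by (intro mult_mono) auto
      then show "((1 + b / 2) * exp (1 / 24))\<^sup>2 \<le> 3 * (1 + b\<^sup>2)" by (simp add: power_mult_distrib)
    qed
    finally show ?thesis by (simp add: mult_right_mono)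
  qed
  ultimately have "(1 + b / 2 + P / 2) * exp (a / 2)
      \<le> 2 * P * exp (a\<^sup>2) + sqrt (3 * (1 + b\<^sup>2)) * exp (3 * a\<^sup>2 / 2)"
    by (simp add: distrib_right)
  moreover have "3 * T\<^sup>2 * K\<^sup>2 / (2 * l) = 3 * a\<^sup>2 / 2" by (simp add: ab field_simps)
  moreover have "K / (2 * sqrt l) * T = a / 2" by (simp add: a_def)
  moreover have "1 / (2 * sqrt l) = b / 2" by (simp add: b_def)
  ultimately show ?thesis unfolding error_const_def ab(1)[symmetric] ab(2)[symmetric] by metis
qed

lemma cutoff_time_iff:
  assumes "0 < \<epsilon>"
  shows "cutoff_time T \<epsilon> s \<longleftrightarrow> 0 < s \<and> s < T \<and> T - s = \<epsilon> powr (1 - s / T)"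
proof -
  have "\<epsilon> powr (2 - 2 * s / T) = (\<epsilon> powr (1 - s / T))\<^sup>2"
    using assms by (simp add: power2_eq_square powr_add[symmetric])
  moreover have "(T - s)\<^sup>2 = (\<epsilon> powr (1 - s / T))\<^sup>2 \<longleftrightarrow> T - s = \<epsilon> powr (1 - s / T)" if "s < T"
    using that by (intro power2_eq_iff_nonneg) auto
  ultimately show ?thesis by (auto simp: cutoff_time_def)
qed

text \<open>
  The function \<open>h\<close> below decreases strictly from \<open>T - \<epsilon> > 0\<close> at \<open>0\<close> to \<open>- 1\<close> at \<open>T\<close>.
\<close>

lemma cutoff_time_ex1:
  assumes "0 < \<epsilon>" "\<epsilon> < 1" "\<epsilon> < T"
  shows "\<exists>!s. cutoff_time T \<epsilon> s"
proof -
  have T: "0 < T" using assms by simp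
  define h where "h = (\<lambda>s. (T - s) - \<epsilon> powr (1 - s / T))"
  have h0: "h 0 > 0" and hT: "h T < 0" using assms T by (auto simp: h_def)
  have decr: "h s' < h s" if "s < s'" for s s'
  proof -
    have "\<epsilon> powr (1 - s / T) < \<epsilon> powr (1 - s' / T)"
      using assms that T by (intro powr_less_mono') (auto simp: divide_strict_right_mono)
    then show ?thesis using that by (simp add: h_def)
  qed
  have "continuous_on {0..T} h"
    unfolding h_def using assms T by (intro continuous_intros) auto
  then obtain s where s: "0 \<le> s" "s \<le> T" "h s = 0"
    using IVT2'[of h T 0 0] h0 hT T by auto
  then have "0 < s" "s < T" using h0 hT by (auto simp: less_le)
  then have "cutoff_time T \<epsilon> s" using s assms by (simp add: cutoff_time_iff h_def)
  moreover have "s' = s" if "cutoff_time T \<epsilon> s'" for s'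
  proof -
    have "h s' = 0" using that assms by (simp add: cutoff_time_iff h_def)
    then show ?thesis using decr[of s s'] decr[of s' s] s by (cases s s' rule: linorder_cases) auto
  qed
  ultimately show ?thesis by blast
qed

text \<open>
  The distance \<open>\<delta> = T - s\<close> solves \<open>\<delta> = exp (- x)\<close> with \<open>x = L * \<delta> / T\<close> and \<open>L = ln (1 / \<epsilon>)\<close>.  Replacing one of
  the two factors of \<open>\<delta>\<^sup>2\<close> by \<open>x * T / L\<close> and the other by \<open>exp (- x)\<close> leaves \<open>T / L * (x * exp (- x))\<close>.
\<close>

lemma cutoff_time_distance:
  assumes "0 < \<epsilon>" "\<epsilon> < 1" "cutoff_time T \<epsilon> s"
  shows "T - s \<le> sqrt (T / ln (1 / \<epsilon>))"
proof (rule real_le_rsqrt)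
  define L \<delta> where "L = ln (1 / \<epsilon>)" and "\<delta> = T - s"
  have L: "L > 0" using assms by (simp add: L_def)
  have s: "0 < s" "s < T" "\<delta> = \<epsilon> powr (1 - s / T)" using assms by (auto simp: cutoff_time_iff \<delta>_def)
  define x where "x = L * \<delta> / T"
  have x: "\<delta> = x * T / L" using L s by (simp add: x_def)
  have "1 - s / T = \<delta> / T" using s(1,2) by (simp add: \<delta>_def diff_divide_distrib)
  then have "\<delta> = \<epsilon> powr (\<delta> / T)" using s(3) by metis
  also have "\<dots> = exp (- x)" using assms(1) by (simp add: powr_def x_def L_def ln_div)
  finally have "\<delta> = exp (- x)" .
  then have "\<delta>\<^sup>2 = (x * T / L) * exp (- x)" unfolding power2_eq_square using x by metis
  also have "\<dots> = (T / L) * (x * exp (- x))" by simp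
  also have "\<dots> \<le> (T / L) * 1"
  proof (rule mult_left_mono)
    have "x \<le> exp x" using exp_ge_add_one_self[of x] by linarith
    then show "x * exp (- x) \<le> 1" by (simp add: exp_minus field_simps)
  qed (use L s in simp)
  finally show "(T - s)\<^sup>2 \<le> T / ln (1 / \<epsilon>)" by (simp add: L_def \<delta>_def)
qed

section \<open>The regularized problem as a Volterra equation\<close>

text \<open>
  Times are clamped to \<open>{0..T}\<close>, so that the families are defined and uniformly bounded on the whole line:
  the decaying exponentials are unbounded in \<open>p\<close> at negative times, the filtered growing exponentials at
  times beyond \<open>T\<close>.
\<close>

definition reg_cosine_operator ::
  "(nat \<Rightarrow> 'h::real_inner) \<Rightarrow> (nat \<Rightarrow> real) \<Rightarrow> real \<Rightarrow> real \<Rightarrow> real \<Rightarrow> 'h \<Rightarrow> 'h" where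
  "reg_cosine_operator e lam T \<epsilon> \<tau> =
     diagonal_operator e (\<lambda>p. cosh_reg T \<epsilon> (lam p) (max 0 (min T \<tau>)))"

definition reg_sine_operator ::
  "(nat \<Rightarrow> 'h::real_inner) \<Rightarrow> (nat \<Rightarrow> real) \<Rightarrow> real \<Rightarrow> real \<Rightarrow> real \<Rightarrow> 'h \<Rightarrow> 'h" where
  "reg_sine_operator e lam T \<epsilon> \<tau> =
     diagonal_operator e (\<lambda>p. sinh_reg T \<epsilon> (lam p) (max 0 (min T \<tau>)) / sqrt (lam p))"

lemma cosh_reg_uniform_bound:
  fixes lam :: "nat \<Rightarrow> real"
  assumes lam: "0 < lam 0" "mono lam" and T: "0 < T" and \<epsilon>: "0 < \<epsilon>" "\<epsilon> < 1" and \<tau>: "\<tau> \<in> {0..T}"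
  shows "\<bar>cosh_reg T \<epsilon> (lam p) \<tau>\<bar> \<le> exp (ln (1 / \<epsilon>) / T * \<tau>)"
  using assms monoD[OF lam(2), of 0 p] by (intro cosh_reg_bound) auto

lemma sinh_reg_uniform_bound:
  fixes lam :: "nat \<Rightarrow> real"
  assumes lam: "0 < lam 0" "mono lam" and T: "0 < T" and \<epsilon>: "0 < \<epsilon>" "\<epsilon> < 1" and \<tau>: "\<tau> \<in> {0..T}"
  shows "\<bar>sinh_reg T \<epsilon> (lam p) \<tau> / sqrt (lam p)\<bar>
           \<le> 1 / (2 * sqrt (lam 0)) * exp (ln (1 / \<epsilon>) / T * \<tau>)"
proof -
  have l: "lam 0 \<le> lam p" using monoD[OF lam(2), of 0 p] by simp
  have "\<bar>sinh_reg T \<epsilon> (lam p) \<tau> / sqrt (lam p)\<bar> = \<bar>sinh_reg T \<epsilon> (lam p) \<tau>\<bar> / sqrt (lam p)"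
    using l lam by (simp add: abs_divide)
  also have "\<dots> \<le> (exp (ln (1 / \<epsilon>) / T * \<tau>) / 2) / sqrt (lam 0)"
    using assms l by (intro frac_le sinh_reg_bound) auto
  finally show ?thesis by simp
qed

lemma exp_clamp_le:
  assumes "0 < T" "0 < \<epsilon>" "\<epsilon> < (1::real)"
  shows "exp (ln (1 / \<epsilon>) / T * max 0 (min T \<tau>)) \<le> exp (ln (1 / \<epsilon>) / T * T)"
proof -
  have "0 \<le> ln (1 / \<epsilon>) / T" using assms by (intro divide_nonneg_nonneg ln_ge_zero) auto
  then have "ln (1 / \<epsilon>) / T * max 0 (min T \<tau>) \<le> ln (1 / \<epsilon>) / T * T"
    using assms by (intro mult_left_mono) auto
  then show ?thesis by simp
qed

lemma cosh_reg_clamped_bound: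
  fixes lam :: "nat \<Rightarrow> real"
  assumes lam: "0 < lam 0" "mono lam" and T: "0 < T" and \<epsilon>: "0 < \<epsilon>" "\<epsilon> < 1"
  shows "\<bar>cosh_reg T \<epsilon> (lam p) (max 0 (min T \<tau>))\<bar> \<le> exp (ln (1 / \<epsilon>) / T * T)"
  using cosh_reg_uniform_bound[OF assms, of "max 0 (min T \<tau>)" p] exp_clamp_le[OF T \<epsilon>, of \<tau>] T
  by (meson atLeastAtMost_iff less_imp_le max.bounded_iff max.cobounded1 min.cobounded1 order_trans)

lemma sinh_reg_clamped_bound:
  fixes lam :: "nat \<Rightarrow> real"
  assumes lam: "0 < lam 0" "mono lam" and T: "0 < T" and \<epsilon>: "0 < \<epsilon>" "\<epsilon> < 1"
  shows "\<bar>sinh_reg T \<epsilon> (lam p) (max 0 (min T \<tau>)) / sqrt (lam p)\<bar>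
           \<le> 1 / (2 * sqrt (lam 0)) * exp (ln (1 / \<epsilon>) / T * T)"
proof -
  have "\<bar>sinh_reg T \<epsilon> (lam p) (max 0 (min T \<tau>)) / sqrt (lam p)\<bar>
      \<le> 1 / (2 * sqrt (lam 0)) * exp (ln (1 / \<epsilon>) / T * max 0 (min T \<tau>))"
    using T by (intro sinh_reg_uniform_bound[OF assms]) auto
  also have "\<dots> \<le> 1 / (2 * sqrt (lam 0)) * exp (ln (1 / \<epsilon>) / T * T)"
    using lam by (intro mult_left_mono exp_clamp_le T \<epsilon>) auto
  finally show ?thesis .
qed

lemma reg_operators:
  fixes e :: "nat \<Rightarrow> 'h::{real_inner, banach}"
  assumes e: "orthonormal_basis e" and lam: "0 < lam 0" "mono lam"
    and T: "0 < T" and \<epsilon>: "0 < \<epsilon>" "\<epsilon> < 1"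
  shows linear_reg_cosine: "linear (reg_cosine_operator e lam T \<epsilon> \<tau>)"
    and linear_reg_sine: "linear (reg_sine_operator e lam T \<epsilon> \<tau>)"
    and continuous_reg_cosine: "continuous_on UNIV (\<lambda>\<tau>. reg_cosine_operator e lam T \<epsilon> \<tau> x)"
    and continuous_reg_sine: "continuous_on UNIV (\<lambda>\<tau>. reg_sine_operator e lam T \<epsilon> \<tau> x)"
    and norm_reg_sine_le: "norm (reg_sine_operator e lam T \<epsilon> \<tau> x)
          \<le> 1 / (2 * sqrt (lam 0)) * exp (ln (1 / \<epsilon>) / T * T) * norm x"
    and reg_cosine_growth: "\<tau> \<in> {0..T} \<Longrightarrow>
          norm (reg_cosine_operator e lam T \<epsilon> \<tau> x) \<le> exp (ln (1 / \<epsilon>) / T * \<tau>) * norm x"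
    and reg_sine_growth: "\<tau> \<in> {0..T} \<Longrightarrow> norm (reg_sine_operator e lam T \<epsilon> \<tau> x)
          \<le> 1 / (2 * sqrt (lam 0)) * exp (ln (1 / \<epsilon>) / T * \<tau>) * norm x"
    and inner_reg_cosine: "\<tau> \<in> {0..T} \<Longrightarrow>
          inner (reg_cosine_operator e lam T \<epsilon> \<tau> x) (e p) = cosh_reg T \<epsilon> (lam p) \<tau> * inner x (e p)"
    and inner_reg_sine: "\<tau> \<in> {0..T} \<Longrightarrow>
          inner (reg_sine_operator e lam T \<epsilon> \<tau> x) (e p)
            = sinh_reg T \<epsilon> (lam p) \<tau> / sqrt (lam p) * inner x (e p)"
proof -
  note cb = cosh_reg_clamped_bound[OF lam T \<epsilon>] and sb = sinh_reg_clamped_bound[OF lam T \<epsilon>]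
  show "linear (reg_cosine_operator e lam T \<epsilon> \<tau>)"
    unfolding reg_cosine_operator_def by (rule linear_diagonal_operator[OF e cb])
  show "linear (reg_sine_operator e lam T \<epsilon> \<tau>)"
    unfolding reg_sine_operator_def by (rule linear_diagonal_operator[OF e sb])
  show "continuous_on UNIV (\<lambda>\<tau>. reg_cosine_operator e lam T \<epsilon> \<tau> x)"
    unfolding reg_cosine_operator_def
    by (rule continuous_diagonal_operator[OF e cb])
      (unfold cosh_reg_def, intro continuous_intros, auto)
  show "continuous_on UNIV (\<lambda>\<tau>. reg_sine_operator e lam T \<epsilon> \<tau> x)"
    unfolding reg_sine_operator_def
    by (rule continuous_diagonal_operator[OF e sb])
      (unfold sinh_reg_def divide_inverse, intro continuous_intros)
  show "norm (reg_sine_operator e lam T \<epsilon> \<tau> x)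
          \<le> 1 / (2 * sqrt (lam 0)) * exp (ln (1 / \<epsilon>) / T * T) * norm x"
    unfolding reg_sine_operator_def by (rule norm_diagonal_operator_le[OF e sb])
  assume \<tau>: "\<tau> \<in> {0..T}"
  then have cl: "max 0 (min T \<tau>) = \<tau>" by auto
  show "norm (reg_cosine_operator e lam T \<epsilon> \<tau> x) \<le> exp (ln (1 / \<epsilon>) / T * \<tau>) * norm x"
    unfolding reg_cosine_operator_def cl
    by (rule norm_diagonal_operator_le[OF e cosh_reg_uniform_bound[OF lam T \<epsilon> \<tau>]])
  show "norm (reg_sine_operator e lam T \<epsilon> \<tau> x)
          \<le> 1 / (2 * sqrt (lam 0)) * exp (ln (1 / \<epsilon>) / T * \<tau>) * norm x"
    unfolding reg_sine_operator_def cl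
    by (rule norm_diagonal_operator_le[OF e sinh_reg_uniform_bound[OF lam T \<epsilon> \<tau>]])
  show "inner (reg_cosine_operator e lam T \<epsilon> \<tau> x) (e p) = cosh_reg T \<epsilon> (lam p) \<tau> * inner x (e p)"
    unfolding reg_cosine_operator_def cl
    by (rule inner_diagonal_operator[OF e cosh_reg_uniform_bound[OF lam T \<epsilon> \<tau>]])
  show "inner (reg_sine_operator e lam T \<epsilon> \<tau> x) (e p)
            = sinh_reg T \<epsilon> (lam p) \<tau> / sqrt (lam p) * inner x (e p)"
    unfolding reg_sine_operator_def cl
    by (rule inner_diagonal_operator[OF e sinh_reg_uniform_bound[OF lam T \<epsilon> \<tau>]])
qed

lemma inner_set_integral:
  fixes h :: "'a \<Rightarrow> 'h::{real_inner, banach, second_countable_topology}"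
  assumes "set_integrable M A h"
  shows "inner (LINT x:A|M. h x) y = (LINT x:A|M. inner (h x) y)"
    and "set_integrable M A (\<lambda>x. inner (h x) y)"
proof -
  have i: "integrable M (\<lambda>x. indicator A x *\<^sub>R h x)" using assms by (simp add: set_integrable_def)
  show "inner (LINT x:A|M. h x) y = (LINT x:A|M. inner (h x) y)"
    using integral_inner_left[of y M "\<lambda>x. indicator A x *\<^sub>R h x"] i
    by (simp add: set_lebesgue_integral_def)
  show "set_integrable M A (\<lambda>x. inner (h x) y)"
    using integrable_inner_left[of y M "\<lambda>x. indicator A x *\<^sub>R h x"] i
    by (simp add: set_integrable_def)
qed

lemma inner_reg_convolution:
  fixes e :: "nat \<Rightarrow> 'h::{real_inner, banach, second_countable_topology}"
  assumes e: "orthonormal_basis e" and lam: "0 < lam 0" "mono lam"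
    and T: "0 < T" and \<epsilon>: "0 < \<epsilon>" "\<epsilon> < 1"
    and h: "set_integrable lborel {0..T} h" and t: "t \<in> {0..T}"
  shows "inner (LBINT s:{0..t}. reg_sine_operator e lam T \<epsilon> (t - s) (h s)) (e p)
           = (LBINT s:{0..t}. sinh_reg T \<epsilon> (lam p) (t - s) / sqrt (lam p) * inner (h s) (e p))"
proof -
  note setting = e lam T \<epsilon>
  have "set_integrable lborel {0..t} (\<lambda>s. reg_sine_operator e lam T \<epsilon> (t - s) (h s))"
    by (rule convolution_set_integrable[OF linear_reg_sine[OF setting] norm_reg_sine_le[OF setting] continuous_reg_sine[OF setting] h t])
  then have "inner (LBINT s:{0..t}. reg_sine_operator e lam T \<epsilon> (t - s) (h s)) (e p)
      = (LBINT s:{0..t}. inner (reg_sine_operator e lam T \<epsilon> (t - s) (h s)) (e p))"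
    by (rule inner_set_integral)
  also have "\<dots> = (LBINT s:{0..t}. sinh_reg T \<epsilon> (lam p) (t - s) / sqrt (lam p) * inner (h s) (e p))"
    using t by (intro set_lebesgue_integral_cong) (auto simp: inner_reg_sine[OF setting])
  finally show ?thesis .
qed

text \<open>
  Both sides prescribe the same coefficients of \<open>v t\<close> with respect to the basis.
\<close>

lemma regularized_mild_solution_iff_volterra:
  fixes e :: "nat \<Rightarrow> 'h::{real_inner, banach, second_countable_topology}"
  assumes e: "orthonormal_basis e" and lam: "0 < lam 0" "mono lam"
    and T: "0 < T" and \<epsilon>: "0 < \<epsilon>" "\<epsilon> < 1"
    and lip: "\<And>t w v. norm (f t w - f t v) \<le> K * norm (w - v)"
    and int: "\<And>w. set_integrable lborel {0..T} (\<lambda>t. f t w)"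
  shows "regularized_mild_solution e lam T f \<epsilon> \<phi> g v \<longleftrightarrow>
     continuous_on {0..T} v \<and>
     (\<forall>t\<in>{0..T}. v t = (reg_cosine_operator e lam T \<epsilon> t \<phi> + reg_sine_operator e lam T \<epsilon> t g)
        + (LBINT s:{0..t}. reg_sine_operator e lam T \<epsilon> (t - s) (f s (v s))))"
proof -
  note setting = e lam T \<epsilon>
  have "v t = (reg_cosine_operator e lam T \<epsilon> t \<phi> + reg_sine_operator e lam T \<epsilon> t g)
        + (LBINT s:{0..t}. reg_sine_operator e lam T \<epsilon> (t - s) (f s (v s))) \<longleftrightarrow>
      (\<lambda>p. (cosh_reg T \<epsilon> (lam p) t * inner \<phi> (e p)
              + sinh_reg T \<epsilon> (lam p) t / sqrt (lam p) * inner g (e p)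
              + (LBINT s:{0..t}. sinh_reg T \<epsilon> (lam p) (t - s) / sqrt (lam p) * inner (f s (v s)) (e p)))
             *\<^sub>R e p) sums v t" (is "_ = ?rhs \<longleftrightarrow> _")
    if v: "continuous_on {0..T} v" and t: "t \<in> {0..T}" for t
  proof -
    have h: "set_integrable lborel {0..T} (\<lambda>s. f s (v s))"
      using T by (intro composition_set_integrable[OF _ lip int v]) auto
    have rhs: "inner ?rhs (e p) = cosh_reg T \<epsilon> (lam p) t * inner \<phi> (e p)
              + sinh_reg T \<epsilon> (lam p) t / sqrt (lam p) * inner g (e p)
              + (LBINT s:{0..t}. sinh_reg T \<epsilon> (lam p) (t - s) / sqrt (lam p) * inner (f s (v s)) (e p))" for p
      by (simp only: inner_add_left inner_reg_cosine[OF setting t] inner_reg_sine[OF setting t] inner_reg_convolution[OF e lam T \<epsilon> h t])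
    show ?thesis
      unfolding onb_sums_iff[OF e]
    proof (intro iffI allI)
      assume "v t = ?rhs"
      from arg_cong[OF this, of "\<lambda>x. inner x (e p)" for p] show "inner (v t) (e p) = cosh_reg T \<epsilon> (lam p) t * inner \<phi> (e p)
              + sinh_reg T \<epsilon> (lam p) t / sqrt (lam p) * inner g (e p)
              + (LBINT s:{0..t}. sinh_reg T \<epsilon> (lam p) (t - s) / sqrt (lam p) * inner (f s (v s)) (e p))" for p
        unfolding rhs .
    next
      assume coeff: "\<forall>p. inner (v t) (e p) = cosh_reg T \<epsilon> (lam p) t * inner \<phi> (e p)
              + sinh_reg T \<epsilon> (lam p) t / sqrt (lam p) * inner g (e p)
              + (LBINT s:{0..t}. sinh_reg T \<epsilon> (lam p) (t - s) / sqrt (lam p) * inner (f s (v s)) (e p))"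
      show "v t = ?rhs"
        by (rule onb_eqI[OF e]) (unfold rhs, rule coeff[rule_format])
    qed
  qed
  then show ?thesis unfolding regularized_mild_solution_def by blast
qed

text \<open>
  By \<open>mode_residual\<close> the coefficients of the residual are \<open>(1 - Q) / 2\<close> times those bounded a priori;
  \<open>filter_defect_bound\<close> trades \<open>1 - Q\<close> for the weight \<open>exp (sqrt (lam p) * (T - t))\<close> of the a priori bound.
\<close>

lemma mild_solution_volterra_residual:
  fixes e :: "nat \<Rightarrow> 'h::{real_inner, banach, second_countable_topology}"
  assumes e: "orthonormal_basis e" and lam: "0 < lam 0" "mono lam"
    and T: "0 < T" and \<epsilon>: "0 < \<epsilon>" "\<epsilon> < 1" and P: "0 \<le> P"
    and lip: "\<And>t w v. norm (f t w - f t v) \<le> K * norm (w - v)"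
    and int: "\<And>w. set_integrable lborel {0..T} (\<lambda>t. f t w)"
    and u: "mild_solution e lam T f \<phi> g u"
    and u': "(u has_vector_derivative u') (at t within {0..T})"
    and sm: "summable (\<lambda>p. exp (2 * sqrt (lam p) * (T - t))
                         * (inner (u t) (e p) + inner u' (e p) / sqrt (lam p))\<^sup>2)"
    and le: "(\<Sum>p. exp (2 * sqrt (lam p) * (T - t))
                 * (inner (u t) (e p) + inner u' (e p) / sqrt (lam p))\<^sup>2) \<le> P\<^sup>2"
    and t: "t \<in> {0..T}"
  shows "norm (u t - (LBINT s:{0..t}. reg_sine_operator e lam T \<epsilon> (t - s) (f s (u s)))
             - (reg_cosine_operator e lam T \<epsilon> t \<phi> + reg_sine_operator e lam T \<epsilon> t g))
           \<le> \<epsilon> * exp (ln (1 / \<epsilon>) / T * t) * P / 2" (is "norm ?r \<le> _")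
proof (rule onb_norm_bound[OF e])
  note setting = e lam T \<epsilon>
  show "0 \<le> \<epsilon> * exp (ln (1 / \<epsilon>) / T * t) * P / 2" using \<epsilon> P by simp
  have uc: "continuous_on {0..T} u" using u by (simp add: mild_solution_def)
  have h: "set_integrable lborel {0..T} (\<lambda>s. f s (u s))"
    using T by (intro composition_set_integrable[OF _ lip int uc]) auto
  define E where "E = (\<lambda>p. inner (u t) (e p) + inner u' (e p) / sqrt (lam p))"
  have r: "inner ?r (e p) = (1 - Q_reg T \<epsilon> (lam p)) / 2 * E p" for p
  proof -
    have l: "0 < lam p" using lam monoD[OF lam(2), of 0 p] by simp
    have "inner ?r (e p) = inner (u t) (e p) - (cosh_reg T \<epsilon> (lam p) t * inner \<phi> (e p)
              + sinh_reg T \<epsilon> (lam p) t / sqrt (lam p) * inner g (e p)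
              + (LBINT s:{0..t}. sinh_reg T \<epsilon> (lam p) (t - s) / sqrt (lam p) * inner (f s (u s)) (e p)))"
      unfolding inner_add_left inner_diff_left inner_reg_cosine[OF setting t] inner_reg_sine[OF setting t]
        inner_reg_convolution[OF e lam T \<epsilon> h t] by simp
    also have "\<dots> = (1 - Q_reg T \<epsilon> (lam p)) / 2 * E p"
      unfolding E_def
    proof (rule mode_residual[OF l T inner_set_integral(2)[OF h] _ _ t])
      show "inner (u t) (e p) = cosh (sqrt (lam p) * t) * inner \<phi> (e p)
              + sinh (sqrt (lam p) * t) / sqrt (lam p) * inner g (e p)
              + (LBINT s:{0..t}. sinh (sqrt (lam p) * (t - s)) / sqrt (lam p) * inner (f s (u s)) (e p))"
        if "t \<in> {0..T}" for t
        using u that unfolding mild_solution_def onb_sums_iff[OF e] by blast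
      show "((\<lambda>t. inner (u t) (e p)) has_real_derivative inner u' (e p)) (at t within {0..T})"
        unfolding has_real_derivative_iff_has_vector_derivative
        by (rule bounded_linear.has_vector_derivative[OF bounded_linear_inner_left u'])
    qed
    finally show ?thesis .
  qed
  fix n
  let ?c = "\<epsilon> * exp (ln (1 / \<epsilon>) / T * t) / 2"
  have "(\<Sum>p<n. (inner ?r (e p))\<^sup>2) \<le> (\<Sum>p<n. ?c\<^sup>2 * (exp (2 * sqrt (lam p) * (T - t)) * (E p)\<^sup>2))"
  proof (rule sum_mono)
    fix p
    have "((1 - Q_reg T \<epsilon> (lam p)) / 2)\<^sup>2 \<le> (?c * exp (sqrt (lam p) * (T - t)))\<^sup>2"
      using filter_defect_bound[OF T \<epsilon> t, of "lam p"] by (intro power_mono) auto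
    also have "\<dots> = ?c\<^sup>2 * exp (2 * sqrt (lam p) * (T - t))"
      by (simp only: power_mult_distrib exp_double[symmetric] mult.assoc)
    finally have "((1 - Q_reg T \<epsilon> (lam p)) / 2)\<^sup>2 * (E p)\<^sup>2 \<le> (?c\<^sup>2 * exp (2 * sqrt (lam p) * (T - t))) * (E p)\<^sup>2"
      by (rule mult_right_mono) simp
    then show "(inner ?r (e p))\<^sup>2 \<le> ?c\<^sup>2 * (exp (2 * sqrt (lam p) * (T - t)) * (E p)\<^sup>2)"
      unfolding r power_mult_distrib[of _ "E p"] by (simp only: mult.assoc)
  qed
  also have "\<dots> \<le> ?c\<^sup>2 * P\<^sup>2"
    unfolding sum_distrib_left[symmetric]
  proof (rule mult_left_mono)
    have "(\<Sum>p<n. exp (2 * sqrt (lam p) * (T - t)) * (E p)\<^sup>2)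
        \<le> (\<Sum>p. exp (2 * sqrt (lam p) * (T - t)) * (E p)\<^sup>2)"
      using sm unfolding E_def by (intro sum_le_suminf) auto
    also have "\<dots> \<le> P\<^sup>2" using le by (simp add: E_def)
    finally show "(\<Sum>p<n. exp (2 * sqrt (lam p) * (T - t)) * (E p)\<^sup>2) \<le> P\<^sup>2" .
  qed simp
  also have "\<dots> = (\<epsilon> * exp (ln (1 / \<epsilon>) / T * t) * P / 2)\<^sup>2"
    by (simp add: power_mult_distrib power_divide)
  finally show "(\<Sum>p<n. (inner ?r (e p))\<^sup>2) \<le> (\<epsilon> * exp (ln (1 / \<epsilon>) / T * t) * P / 2)\<^sup>2" .
qed

section \<open>Existence, uniqueness and error of the regularized solution\<close>

lemma growth_eq_powr:
  fixes \<epsilon> T t :: real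
  assumes "0 < T" "0 < \<epsilon>"
  shows "\<epsilon> * exp (ln (1 / \<epsilon>) / T * t) = \<epsilon> powr (1 - t / T)"
proof -
  have "\<epsilon> powr (1 - t / T) = exp (ln \<epsilon> + ln (1 / \<epsilon>) / T * t)"
    using assms by (simp add: powr_def ln_div algebra_simps)
  then show ?thesis using assms by (simp add: exp_add)
qed

text \<open>
  Both \<open>v\<close> and \<open>u\<close> solve the Volterra equation with the regularized kernel, for inhomogeneities that
  differ by the propagated noise and by the residual of \<open>u\<close>.  All three contributions are multiples of
  \<open>\<epsilon> * exp (\<mu> * t)\<close>, the perturbation for which \<open>volterra_stability\<close> is made.
\<close>

lemma regularized_mild_solution_error:
  fixes e :: "nat \<Rightarrow> 'h::{real_inner, banach, second_countable_topology}"
  assumes e: "orthonormal_basis e" and lam: "0 < lam 0" "mono lam"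
    and T: "0 < T" and \<epsilon>: "0 < \<epsilon>" "\<epsilon> < 1" and K: "0 \<le> K" and P: "0 \<le> P"
    and lip: "\<And>t w v. norm (f t w - f t v) \<le> K * norm (w - v)"
    and int: "\<And>w. set_integrable lborel {0..T} (\<lambda>t. f t w)"
    and u: "mild_solution e lam T f \<phi> g u"
    and u\<^sub>t: "\<And>t. t \<in> {0..T} \<Longrightarrow> (u has_vector_derivative u\<^sub>t t) (at t within {0..T})"
    and sm: "\<And>t. t \<in> {0..T} \<Longrightarrow>
           summable (\<lambda>p. exp (2 * sqrt (lam p) * (T - t))
                         * (inner (u t) (e p) + inner (u\<^sub>t t) (e p) / sqrt (lam p))\<^sup>2)"
    and le: "\<And>t. t \<in> {0..T} \<Longrightarrow>
           (\<Sum>p. exp (2 * sqrt (lam p) * (T - t))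
                 * (inner (u t) (e p) + inner (u\<^sub>t t) (e p) / sqrt (lam p))\<^sup>2) \<le> P\<^sup>2"
    and \<phi>': "norm (\<phi>' - \<phi>) \<le> \<epsilon>" and g': "norm (g' - g) \<le> \<epsilon>"
    and v: "regularized_mild_solution e lam T f \<epsilon> \<phi>' g' v"
    and t: "t \<in> {0..T}"
  shows "norm (v t - u t) \<le> error_const T K (lam 0) P * \<epsilon> powr (1 - t / T)"
proof -
  note setting = e lam T \<epsilon>
  let ?\<mu> = "ln (1 / \<epsilon>) / T" and ?m = "1 / (2 * sqrt (lam 0))"
  let ?S = "reg_sine_operator e lam T \<epsilon>" and ?C = "reg_cosine_operator e lam T \<epsilon>"
  let ?\<delta> = "\<epsilon> * (1 + ?m + P / 2)"
  have v_eq: "continuous_on {0..T} v"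
    "\<And>t. t \<in> {0..T} \<Longrightarrow> v t = (?C t \<phi>' + ?S t g') + (LBINT s:{0..t}. ?S (t - s) (f s (v s)))"
    using v unfolding regularized_mild_solution_iff_volterra[OF e lam T \<epsilon> lip int] by blast+
  have uc: "continuous_on {0..T} u" using u by (simp add: mild_solution_def)
  \<comment> \<open>the inhomogeneity for which \<open>u\<close> solves the regularized Volterra equation\<close>
  define c where "c = (\<lambda>t. u t - (LBINT s:{0..t}. ?S (t - s) (f s (u s))))"
  have data: "norm ((?C t \<phi>' + ?S t g') - c t) \<le> ?\<delta> * exp (?\<mu> * t)" if t: "t \<in> {0..T}" for t
  proof -
    define r where "r = c t - (?C t \<phi> + ?S t g)"
    have r: "norm r \<le> \<epsilon> * exp (?\<mu> * t) * P / 2"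
      unfolding r_def c_def
      by (rule mild_solution_volterra_residual[OF e lam T \<epsilon> P lip int u u\<^sub>t[OF t] sm[OF t] le[OF t] t])
    have "norm (?C t (\<phi>' - \<phi>)) \<le> exp (?\<mu> * t) * norm (\<phi>' - \<phi>)" by (rule reg_cosine_growth[OF setting t])
    also have "\<dots> \<le> exp (?\<mu> * t) * \<epsilon>" using \<phi>' by (intro mult_left_mono) auto
    finally have C_le: "norm (?C t (\<phi>' - \<phi>)) \<le> exp (?\<mu> * t) * \<epsilon>" .
    have "norm (?S t (g' - g)) \<le> ?m * exp (?\<mu> * t) * norm (g' - g)" by (rule reg_sine_growth[OF setting t])
    also have "\<dots> \<le> ?m * exp (?\<mu> * t) * \<epsilon>" using g' lam by (intro mult_left_mono) auto
    finally have S_le: "norm (?S t (g' - g)) \<le> ?m * exp (?\<mu> * t) * \<epsilon>" .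
    have "(?C t \<phi>' + ?S t g') - c t = (?C t (\<phi>' - \<phi>) + ?S t (g' - g)) - r"
      unfolding r_def linear_diff[OF linear_reg_cosine[OF setting]] linear_diff[OF linear_reg_sine[OF setting]] by (simp add: algebra_simps)
    then have "norm ((?C t \<phi>' + ?S t g') - c t) \<le> norm (?C t (\<phi>' - \<phi>)) + norm (?S t (g' - g)) + norm r"
      by (simp only: order_trans[OF norm_triangle_ineq4 add_right_mono[OF norm_triangle_ineq]])
    also have "\<dots> \<le> exp (?\<mu> * t) * \<epsilon> + ?m * exp (?\<mu> * t) * \<epsilon> + \<epsilon> * exp (?\<mu> * t) * P / 2"
      by (intro add_mono C_le S_le r)
    also have "\<dots> = ?\<delta> * exp (?\<mu> * t)" by (simp add: algebra_simps)
    finally show ?thesis .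
  qed
  have "norm (v t - u t) \<le> ?\<delta> * exp ((?\<mu> + ?m * K) * t)"
  proof (rule volterra_stability[OF linear_reg_sine[OF setting] norm_reg_sine_le[OF setting] continuous_reg_sine[OF setting] reg_sine_growth[OF setting] _ K _ lip int v_eq uc _ data t])
    show "u t = c t + (LBINT s:{0..t}. ?S (t - s) (f s (u s)))" for t by (simp add: c_def)
    show "0 \<le> ?m" using lam by simp
    show "0 \<le> T" using T by simp
  qed
  also have "\<dots> = (\<epsilon> * exp (?\<mu> * t)) * ((1 + ?m + P / 2) * exp (K / (2 * sqrt (lam 0)) * t))"
  proof -
    have "exp ((?\<mu> + ?m * K) * t) = exp (?\<mu> * t) * exp (K / (2 * sqrt (lam 0)) * t)"
      unfolding exp_add[symmetric] by (simp add: distrib_right)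
    then show ?thesis by (simp only: ac_simps)
  qed
  also have "\<dots> \<le> (\<epsilon> * exp (?\<mu> * t)) * error_const T K (lam 0) P"
  proof (rule mult_left_mono)
    have "(1 + ?m + P / 2) * exp (K / (2 * sqrt (lam 0)) * t)
        \<le> (1 + ?m + P / 2) * exp (K / (2 * sqrt (lam 0)) * T)"
      using t K P lam by (intro mult_left_mono) (auto intro!: mult_left_mono divide_right_mono)
    also have "\<dots> \<le> error_const T K (lam 0) P"
      using T K P lam by (intro error_const_dominates) auto
    finally show "(1 + ?m + P / 2) * exp (K / (2 * sqrt (lam 0)) * t) \<le> error_const T K (lam 0) P" .
  qed (use \<epsilon> in simp)
  finally show ?thesis unfolding growth_eq_powr[OF T \<epsilon>(1)] by (simp only: mult.commute)
qed

lemma regularized_mild_solution_unique: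
  fixes e :: "nat \<Rightarrow> 'h::{real_inner, banach, second_countable_topology}"
  assumes e: "orthonormal_basis e" and lam: "0 < lam 0" "mono lam"
    and T: "0 < T" and \<epsilon>: "0 < \<epsilon>" "\<epsilon> < 1" and K: "0 \<le> K"
    and lip: "\<And>t w v. norm (f t w - f t v) \<le> K * norm (w - v)"
    and int: "\<And>w. set_integrable lborel {0..T} (\<lambda>t. f t w)"
    and v: "regularized_mild_solution e lam T f \<epsilon> \<phi> g v"
    and w: "regularized_mild_solution e lam T f \<epsilon> \<phi> g w"
    and t: "t \<in> {0..T}"
  shows "w t = v t"
proof -
  note setting = e lam T \<epsilon>
  note iff = regularized_mild_solution_iff_volterra[OF e lam T \<epsilon> lip int]
  have "norm (w t - v t) \<le> 0 * exp ((ln (1 / \<epsilon>) / T + 1 / (2 * sqrt (lam 0)) * K) * t)"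
  proof (rule volterra_stability[OF linear_reg_sine[OF setting] norm_reg_sine_le[OF setting] continuous_reg_sine[OF setting] reg_sine_growth[OF setting] _ K _ lip int _ _ _ _ _ t])
    show "continuous_on {0..T} w" "continuous_on {0..T} v" using v w by (auto simp: iff)
    show "w t = (reg_cosine_operator e lam T \<epsilon> t \<phi> + reg_sine_operator e lam T \<epsilon> t g)
        + (LBINT s:{0..t}. reg_sine_operator e lam T \<epsilon> (t - s) (f s (w s)))"
      and "v t = (reg_cosine_operator e lam T \<epsilon> t \<phi> + reg_sine_operator e lam T \<epsilon> t g)
        + (LBINT s:{0..t}. reg_sine_operator e lam T \<epsilon> (t - s) (f s (v s)))"
      if "t \<in> {0..T}" for t
      using v w that unfolding iff by blast+
  qed (use T lam in auto)
  then show ?thesis by simp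
qed

lemma regularized_mild_solution_exists:
  fixes e :: "nat \<Rightarrow> 'h::{real_inner, banach, second_countable_topology}"
  assumes e: "orthonormal_basis e" and lam: "0 < lam 0" "mono lam"
    and T: "0 < T" and \<epsilon>: "0 < \<epsilon>" "\<epsilon> < 1" and K: "0 \<le> K"
    and lip: "\<And>t w v. norm (f t w - f t v) \<le> K * norm (w - v)"
    and int: "\<And>w. set_integrable lborel {0..T} (\<lambda>t. f t w)"
  obtains v where "regularized_mild_solution e lam T f \<epsilon> \<phi> g v"
proof -
  note setting = e lam T \<epsilon>
  obtain v where "continuous_on {0..T} v"
    "\<And>t. t \<in> {0..T} \<Longrightarrow> v t = (reg_cosine_operator e lam T \<epsilon> t \<phi> + reg_sine_operator e lam T \<epsilon> t g)
        + (LBINT s:{0..t}. reg_sine_operator e lam T \<epsilon> (t - s) (f s (v s)))"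
  proof (rule volterra_existence[OF linear_reg_sine[OF setting] norm_reg_sine_le[OF setting] continuous_reg_sine[OF setting] _ K _ lip int])
    show "continuous_on {0..T} (\<lambda>t. reg_cosine_operator e lam T \<epsilon> t \<phi> + reg_sine_operator e lam T \<epsilon> t g)"
      using continuous_reg_cosine[OF setting] continuous_reg_sine[OF setting] by (intro continuous_intros) (auto intro: continuous_on_subset)
  qed (use T lam in auto)
  then show thesis
    using that regularized_mild_solution_iff_volterra[OF e lam T \<epsilon> lip int] by blast
qed

lemma vector_derivative_bound_imp_lipschitz:
  fixes u :: "real \<Rightarrow> 'h::real_normed_vector"
  assumes u': "\<And>t. t \<in> {a..b} \<Longrightarrow> (u has_vector_derivative u' t) (at t within {a..b})"
    and D: "\<And>t. t \<in> {a..b} \<Longrightarrow> norm (u' t) \<le> D" and xy: "x \<in> {a..b}" "y \<in> {a..b}"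
  shows "norm (u x - u y) \<le> D * \<bar>x - y\<bar>"
proof -
  have "norm (u x - u y) \<le> D * norm (x - y)"
  proof (rule differentiable_bound[where S = "{a..b}" and f' = "\<lambda>t h. h *\<^sub>R u' t"])
    show "(u has_derivative (\<lambda>h. h *\<^sub>R u' t)) (at t within {a..b})" if "t \<in> {a..b}" for t
      using u'[OF that] by (simp add: has_vector_derivative_def)
    show "onorm (\<lambda>h. h *\<^sub>R u' t) \<le> D" if "t \<in> {a..b}" for t
      using D[OF that] order_trans[OF norm_ge_zero D[OF that]]
      by (intro onorm_bound) (auto simp: mult.commute[of D] intro: mult_left_mono)
  qed (use xy in auto)
  then show ?thesis by simp
qed

theorem theorem3p3:
  fixes D\<^sub>A :: "'h::{real_inner, banach, second_countable_topology} set"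
    and A :: "'h \<Rightarrow> 'h"
    and e :: "nat \<Rightarrow> 'h" and lam :: "nat \<Rightarrow> real"
    and f :: "real \<Rightarrow> 'h \<Rightarrow> 'h"
    and \<phi> g \<phi>' g' :: 'h
    and u u\<^sub>t :: "real \<Rightarrow> 'h"
    and T K P \<epsilon> :: real
  assumes "self_adjoint D\<^sub>A A" and "positive_definite D\<^sub>A A" and "has_compact_inverse D\<^sub>A A"
    and "eigenbasis D\<^sub>A A e lam"
    and "T > 0" and "K > 0" and "P > 0"
    and "\<And>t w v. norm (f t w - f t v) \<le> K * norm (w - v)"
    and "\<And>w. set_integrable lborel {0..T} (\<lambda>t. f t w)"
    and "mild_solution e lam T f \<phi> g u"
    and "\<And>t. t \<in> {0..T} \<Longrightarrow> (u has_vector_derivative u\<^sub>t t) (at t within {0..T})"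
    and "\<And>t. t \<in> {0..T} \<Longrightarrow>
           summable (\<lambda>p. exp (2 * sqrt (lam p) * (T - t))
                         * (inner (u t) (e p) + inner (u\<^sub>t t) (e p) / sqrt (lam p))\<^sup>2)"
    and "\<And>t. t \<in> {0..T} \<Longrightarrow>
           (\<Sum>p. exp (2 * sqrt (lam p) * (T - t))
                 * (inner (u t) (e p) + inner (u\<^sub>t t) (e p) / sqrt (lam p))\<^sup>2) \<le> P\<^sup>2"
    and "0 < \<epsilon>" and "\<epsilon> < 1"
    and "norm (\<phi>' - \<phi>) \<le> \<epsilon>" and "norm (g' - g) \<le> \<epsilon>"
  shows "\<exists>v. regularized_mild_solution e lam T f \<epsilon> \<phi>' g' v \<and>
             (\<forall>w. regularized_mild_solution e lam T f \<epsilon> \<phi>' g' w \<longrightarrow> (\<forall>t\<in>{0..T}. w t = v t)) \<and>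
             (\<forall>t\<in>{0..<T}. norm (regularized_solution T \<epsilon> v t - u t)
                            \<le> error_const T K (lam 0) P * \<epsilon> powr (1 - t / T)) \<and>
             (\<epsilon> < T \<longrightarrow>
                (\<exists>!s. cutoff_time T \<epsilon> s) \<and>
                ereal (norm (regularized_solution T \<epsilon> v T - u T))
                  \<le> ((SUP t\<in>{0..T}. ereal (norm (u\<^sub>t t))) + ereal (error_const T K (lam 0) P))
                     * ereal (sqrt (T / ln (1 / \<epsilon>))))"
proof -
  note lip = assms(8) and int = assms(9) and u = assms(10) and u\<^sub>t = assms(11) and T = assms(5)
  have e: "orthonormal_basis e" and lam: "0 < lam 0" "mono lam"
    using assms(4) by (auto simp: eigenbasis_def)
  have \<epsilon>: "0 < \<epsilon>" "\<epsilon> < 1" and K: "0 \<le> K" and P: "0 \<le> P" using assms by auto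
  let ?C = "error_const T K (lam 0) P" and ?Dsup = "SUP t\<in>{0..T}. ereal (norm (u\<^sub>t t))"
  obtain v where v: "regularized_mild_solution e lam T f \<epsilon> \<phi>' g' v"
    by (rule regularized_mild_solution_exists[OF e lam T \<epsilon> K lip int])
  have error: "norm (v t - u t) \<le> ?C * \<epsilon> powr (1 - t / T)" if "t \<in> {0..T}" for t
    by (rule regularized_mild_solution_error[OF e lam T \<epsilon> K P lip int u u\<^sub>t assms(12,13,16,17) v that])
  have final: "(\<exists>!s. cutoff_time T \<epsilon> s) \<and>
      ereal (norm (regularized_solution T \<epsilon> v T - u T))
        \<le> (?Dsup + ereal ?C) * ereal (sqrt (T / ln (1 / \<epsilon>)))" if "\<epsilon> < T"
  proof
    show ex1: "\<exists>!s. cutoff_time T \<epsilon> s" by (rule cutoff_time_ex1[OF \<epsilon> that])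
    then obtain s where s: "cutoff_time T \<epsilon> s" by blast
    then have "(THE s. cutoff_time T \<epsilon> s) = s" using ex1 by (intro the1_equality)
    then have U: "regularized_solution T \<epsilon> v T = v s" by (simp add: regularized_solution_def)
    have s_in: "s \<in> {0..T}" and dist: "T - s = \<epsilon> powr (1 - s / T)"
      using s \<epsilon> by (auto simp: cutoff_time_iff)
    have root: "0 < sqrt (T / ln (1 / \<epsilon>))" using T \<epsilon> by simp
    show "ereal (norm (regularized_solution T \<epsilon> v T - u T))
        \<le> (?Dsup + ereal ?C) * ereal (sqrt (T / ln (1 / \<epsilon>)))"
    \<comment> \<open>\<open>u\<^sub>t\<close> may be unbounded; the right-hand side then is infinite\<close>
    proof (cases "?Dsup = \<infinity>")
      case True
      have "(\<infinity> + ereal ?C) * ereal r = \<infinity>" if "0 < r" for r using that by simp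
      from this[OF root] show ?thesis unfolding True by simp
    next
      case False
      have upper: "ereal (norm (u\<^sub>t t)) \<le> ?Dsup" if "t \<in> {0..T}" for t
        using that by (rule SUP_upper)
      have "0 \<le> ?Dsup" using upper[of 0] T by (auto intro: order_trans[rotated])
      then obtain D where D: "?Dsup = ereal D" "0 \<le> D" using False by (cases ?Dsup) auto
      have "norm (u s - u T) \<le> D * \<bar>s - T\<bar>"
        using upper s_in T unfolding D by (intro vector_derivative_bound_imp_lipschitz[OF u\<^sub>t]) auto
      then have "norm (u s - u T) \<le> D * (T - s)" using s_in by simp
      moreover have "norm (v s - u s) \<le> ?C * (T - s)" using error[OF s_in] by (simp only: dist)
      ultimately have "norm (v s - u T) \<le> (D + ?C) * (T - s)"
        using norm_triangle_ineq[of "v s - u s" "u s - u T"] by (simp add: distrib_right)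
      also have "\<dots> \<le> (D + ?C) * sqrt (T / ln (1 / \<epsilon>))"
      proof (rule mult_left_mono)
        show "T - s \<le> sqrt (T / ln (1 / \<epsilon>))" by (rule cutoff_time_distance[OF \<epsilon> s])
        show "0 \<le> D + ?C" using D P lam by (simp add: error_const_def)
      qed
      finally show ?thesis by (simp add: U D)
    qed
  qed
  show ?thesis
  proof (intro exI conjI allI impI ballI)
    show "regularized_mild_solution e lam T f \<epsilon> \<phi>' g' v" by (rule v)
    show "w t = v t" if "regularized_mild_solution e lam T f \<epsilon> \<phi>' g' w" "t \<in> {0..T}" for w t
      by (rule regularized_mild_solution_unique[OF e lam T \<epsilon> K lip int v that])
    show "norm (regularized_solution T \<epsilon> v t - u t) \<le> ?C * \<epsilon> powr (1 - t / T)" if "t \<in> {0..<T}" for t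
      using error[of t] that by (simp add: regularized_solution_def)
  qed (use final in blast)+
qed

end
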